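(* Let $n\in\mathbb{N}\cup\{\infty\}$, let $T_1\in\mathcal{S}_n(\mathcal{H}_1)$ and $T_2\in\mathcal{S}_n(\mathcal{H}_2)$, and let $\Gamma_1,\Gamma_2$ be models for $T_1,T_2$, respectively, both with the same auxiliary $n$-dimensional Hilbert space $\mathcal{K}$. For $j=1,2$ let $K^j_\lambda(z)=\Gamma_j(z)^*\Gamma_j(\lambda)$ and $$V_j(z)=\frac{z-i}{z+i}\,\Phi_j(z)^{-1}\Psi_j(z),\qquad \Phi_j(z)=K^j_i(z)K^j_i(i)^{-1/2},\quad \Psi_j(z)=K^j_{-i}(z)K^j_{-i}(-i)^{-1/2}.$$ Then $T_1$ is unitarily equivalent to $T_2$ if and only if there are constant unitary operators $R,Q$ on $\mathcal{K}$ such that $$V_1(z)=R\,V_2(z)\,Q,\qquad z\in\mathbb{C}_+.$$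
   Context: $\mathcal{S}_n(\mathcal{H})$ denotes the set of closed, densely defined linear operators $T:\mathscr{D}(T)\subset\mathcal{H}\to\mathcal{H}$ on a complex separable Hilbert space $\mathcal{H}$ that are symmetric ($\langle Tx,y\rangle=\langle x,Ty\rangle$ for all $x,y\in\mathscr{D}(T)$), simple ($\bigcap_{\Im\lambda\neq0}\mathrm{Rng}(T-\lambda I)=\{0\}$), and have deficiency indices $(n,n)$, i.e. $\dim\mathrm{Rng}(T-iI)^\perp=\dim\mathrm{Rng}(T+iI)^\perp=n$. $T_1,T_2$ are unitarily equivalent if there is a unitary $U:\mathcal{H}_1\to\mathcal{H}_2$ with $U\mathscr{D}(T_1)=\mathscr{D}(T_2)$ and $UT_1=T_2U$. $\mathbb{C}_\pm$ are the open upper/lower half planes. $\mathcal{K}$ is a complex separable Hilbert space of dimension $n$. A model for $T$ is a map $\Gamma:\mathbb{C}\setminus\mathbb{R}\to\mathcal{B}(\mathcal{K},\mathcal{H})$ such that: (1) $\Gamma$ is co-analytic (analytic in $\overline{\lambda}$); (2) for each $\lambda\in\mathbb{C}\setminus\mathbb{R}$, $\Gamma(\lambda)$ is an invertible map from $\mathcal{K}$ onto $\mathrm{Rng}(T-\lambda I)^\perp$; (3) $\Gamma(z)^*\Gamma(\lambda):\mathcal{K}\to\mathcal{K}$ is invertible whenever $\lambda,z\in\mathbb{C}_+$ or $\lambda,z\in\mathbb{C}_-$; (4) the closed linear span of $\bigcup_{\Im\lambda\ne0}\mathrm{Rng}\,\Gamma(\lambda)$ is $\mathcal{H}$. (By (3),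 $\Phi_j(z)$ is invertible for $z\in\mathbb{C}_+$.) *)

theory Defs
  imports "HOL-Analysis.Analysis" "HOL-Library.Extended_Nat"
begin

class complex_vector = real_vector +
  fixes scaleC :: "complex \<Rightarrow> 'a \<Rightarrow> 'a" (infixr \<open>*\<^sub>C\<close> 75)
  assumes scaleC_add_right: "c *\<^sub>C (x + y) = c *\<^sub>C x + c *\<^sub>C y"
    and scaleC_add_left: "(c + d) *\<^sub>C x = c *\<^sub>C x + d *\<^sub>C x"
    and scaleC_scaleC: "c *\<^sub>C (d *\<^sub>C x) = (c * d) *\<^sub>C x"
    and scaleC_one: "1 *\<^sub>C x = x"
    and scaleR_scaleC: "r *\<^sub>R x = complex_of_real r *\<^sub>C x"

global_interpretation complex_vector:
  vector_space "scaleC :: complex \<Rightarrow> 'a \<Rightarrow> 'a::complex_vector"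
  by unfold_locales (simp_all add: scaleC_add_right scaleC_add_left scaleC_scaleC scaleC_one)

text \<open>
  The complex inner product is linear in its first argument. Its real part is the real inner
  product of the parent class, so norm, metric and topology are those of \<^class>\<open>real_inner\<close>,
  and definiteness is inherited.
\<close>

class complex_inner = complex_vector + real_inner +
  fixes cinner :: "'a \<Rightarrow> 'a \<Rightarrow> complex"
  assumes cinner_commute: "cinner x y = cnj (cinner y x)"
    and cinner_add_left: "cinner (x + y) z = cinner x z + cinner y z"
    and cinner_scaleC_left: "cinner (c *\<^sub>C x) y = c * cinner x y"
    and inner_eq_Re_cinner: "inner x y = Re (cinner x y)"

class separable_hilbert_space = complex_inner + complete_space +
  assumes separable: "\<exists>S :: 'a set. countable S \<and> (\<forall>U. open U \<longrightarrow> U \<noteq> {} \<longrightarrow> S \<inter> U \<noteq> {})"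

abbreviation clinear :: "('a::complex_vector \<Rightarrow> 'b::complex_vector) \<Rightarrow> bool" where
  "clinear \<equiv> Vector_Spaces.linear scaleC scaleC"

definition orth_compl :: "'a::complex_inner set \<Rightarrow> 'a set" where
  "orth_compl S = {y. \<forall>x\<in>S. cinner x y = 0}"

definition closed_span :: "'a::complex_inner set \<Rightarrow> 'a set" where
  "closed_span S = closure (complex_vector.span S)"

definition orthonormal :: "'a::complex_inner set \<Rightarrow> bool" where
  "orthonormal B \<longleftrightarrow> (\<forall>x\<in>B. norm x = 1) \<and> (\<forall>x\<in>B. \<forall>y\<in>B. x \<noteq> y \<longrightarrow> cinner x y = 0)"

text \<open>
  Hilbert dimension of a closed subspace: the number of elements of an orthonormal basis. In a
  separable space such a basis is countable, so the only infinite value is \<open>\<infinity>\<close>.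
\<close>

definition has_hilbert_dim :: "'a::complex_inner set \<Rightarrow> enat \<Rightarrow> bool" where
  "has_hilbert_dim S n \<longleftrightarrow>
     (\<exists>B. orthonormal B \<and> closed_span B = S \<and> n = (if finite B then enat (card B) else \<infinity>))"

definition unitary :: "('a::complex_inner \<Rightarrow> 'b::complex_inner) \<Rightarrow> bool" where
  "unitary U \<longleftrightarrow> clinear U \<and> surj U \<and> (\<forall>x y. cinner (U x) (U y) = cinner x y)"

text \<open>
  An unbounded operator is given by its domain \<open>D\<close> and a function \<open>T\<close>, whose values outside
  \<open>D\<close> are irrelevant.
\<close>

definition rng_shift :: "'a::complex_inner set \<Rightarrow> ('a \<Rightarrow> 'a) \<Rightarrow> complex \<Rightarrow> 'a set" where
  "rng_shift D T w = (\<lambda>x. T x - w *\<^sub>C x) ` D"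

definition linear_operator :: "'a::complex_inner set \<Rightarrow> ('a \<Rightarrow> 'a) \<Rightarrow> bool" where
  "linear_operator D T \<longleftrightarrow>
     complex_vector.subspace D \<and>
     (\<forall>x\<in>D. \<forall>y\<in>D. T (x + y) = T x + T y) \<and>
     (\<forall>c. \<forall>x\<in>D. T (c *\<^sub>C x) = c *\<^sub>C T x)"

definition closed_operator :: "'a::complex_inner set \<Rightarrow> ('a \<Rightarrow> 'a) \<Rightarrow> bool" where
  "closed_operator D T \<longleftrightarrow> closed ((\<lambda>x. (x, T x)) ` D)"

definition symmetric_operator :: "'a::complex_inner set \<Rightarrow> ('a \<Rightarrow> 'a) \<Rightarrow> bool" where
  "symmetric_operator D T \<longleftrightarrow> (\<forall>x\<in>D. \<forall>y\<in>D. cinner (T x) y = cinner x (T y))"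

definition simple_operator :: "'a::complex_inner set \<Rightarrow> ('a \<Rightarrow> 'a) \<Rightarrow> bool" where
  "simple_operator D T \<longleftrightarrow> (\<Inter>w\<in>{w. Im w \<noteq> 0}. rng_shift D T w) = {0}"

definition S_class :: "enat \<Rightarrow> 'a::complex_inner set \<Rightarrow> ('a \<Rightarrow> 'a) \<Rightarrow> bool" where
  "S_class n D T \<longleftrightarrow>
     linear_operator D T \<and> closed_operator D T \<and> closure D = UNIV \<and>
     symmetric_operator D T \<and> simple_operator D T \<and>
     has_hilbert_dim (orth_compl (rng_shift D T \<i>)) n \<and>
     has_hilbert_dim (orth_compl (rng_shift D T (- \<i>))) n"

definition unitarily_equivalent ::
  "'a::complex_inner set \<Rightarrow> ('a \<Rightarrow> 'a) \<Rightarrow> 'b::complex_inner set \<Rightarrow> ('b \<Rightarrow> 'b) \<Rightarrow> bool" where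
  "unitarily_equivalent D1 T1 D2 T2 \<longleftrightarrow>
     (\<exists>U. unitary U \<and> U ` D1 = D2 \<and> (\<forall>x\<in>D1. U (T1 x) = T2 (U x)))"

lemma norm_scaleC: "norm (c *\<^sub>C x) = cmod c * norm (x::'a::complex_inner)"
proof -
  have "cinner (c *\<^sub>C x) (c *\<^sub>C x) = c * cnj c * cinner x x"
    by (metis cinner_commute cinner_scaleC_left complex_cnj_mult mult.assoc)
  then have "inner (c *\<^sub>C x) (c *\<^sub>C x) = (cmod c)\<^sup>2 * inner x x"
    by (simp add: inner_eq_Re_cinner complex_mult_cnj cmod_power2)
  then show ?thesis
    by (simp add: norm_eq_sqrt_inner real_sqrt_mult)
qed

lemma bounded_linear_scaleC:
  "bounded_linear ((*\<^sub>C) c :: 'a::complex_inner \<Rightarrow> 'a)"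
proof (rule bounded_linear_intro[where K = "cmod c"])
  show "c *\<^sub>C (r *\<^sub>R x) = r *\<^sub>R c *\<^sub>C x" for r and x :: 'a
    by (simp add: scaleR_scaleC scaleC_scaleC mult.commute)
qed (simp_all add: scaleC_add_right norm_scaleC)

text \<open>
  The library type of bounded operators consists of the real-linear ones; membership in
  \<open>\<B>(\<K>, \<H>)\<close> is the additional condition \<^const>\<open>clinear\<close>.
\<close>

instantiation blinfun :: (real_normed_vector, complex_inner) complex_vector
begin

lift_definition scaleC_blinfun :: "complex \<Rightarrow> 'a \<Rightarrow>\<^sub>L 'b \<Rightarrow> 'a \<Rightarrow>\<^sub>L 'b"
  is "\<lambda>c f x. c *\<^sub>C f x"
  by (rule bounded_linear_compose[OF bounded_linear_scaleC])

instance
  by standard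
    (transfer; simp add: scaleC_add_right scaleC_add_left scaleC_scaleC scaleC_one scaleR_scaleC)+

end

text \<open>
  The definite descriptions below are meaningful on complete spaces: the adjoint of a
  \<^const>\<open>clinear\<close> operator, the inverse of an invertible one, and the positive square root of a
  positive one exist, are unique and are again \<^const>\<open>clinear\<close>.
\<close>

definition op_adjoint :: "'a::complex_inner \<Rightarrow>\<^sub>L 'b::complex_inner \<Rightarrow> 'b \<Rightarrow>\<^sub>L 'a" where
  "op_adjoint A = (THE B. \<forall>x y. cinner (blinfun_apply A x) y = cinner x (blinfun_apply B y))"

definition op_invertible :: "'a::complex_inner \<Rightarrow>\<^sub>L 'a \<Rightarrow> bool" where
  "op_invertible A \<longleftrightarrow> (\<exists>B. A o\<^sub>L B = id_blinfun \<and> B o\<^sub>L A = id_blinfun)"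

definition op_inverse :: "'a::complex_inner \<Rightarrow>\<^sub>L 'a \<Rightarrow> 'a \<Rightarrow>\<^sub>L 'a" where
  "op_inverse A = (THE B. A o\<^sub>L B = id_blinfun \<and> B o\<^sub>L A = id_blinfun)"

definition op_positive :: "'a::complex_inner \<Rightarrow>\<^sub>L 'a \<Rightarrow> bool" where
  "op_positive A \<longleftrightarrow>
     clinear (blinfun_apply A) \<and> (\<forall>x. cinner (blinfun_apply A x) x \<in> \<real>\<^sub>\<ge>\<^sub>0)"

definition op_sqrt :: "'a::complex_inner \<Rightarrow>\<^sub>L 'a \<Rightarrow> 'a \<Rightarrow>\<^sub>L 'a" where
  "op_sqrt A = (THE B. op_positive B \<and> B o\<^sub>L B = A)"

text \<open>Complex differentiability with respect to the operator norm.\<close>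

definition op_holomorphic_on ::
  "(complex \<Rightarrow> 'a::complex_inner \<Rightarrow>\<^sub>L 'b::complex_inner) \<Rightarrow> complex set \<Rightarrow> bool" where
  "op_holomorphic_on F S \<longleftrightarrow>
     (\<forall>z\<in>S. \<exists>F'. (F has_derivative (\<lambda>h. h *\<^sub>C F')) (at z within S))"

definition op_coanalytic_on ::
  "(complex \<Rightarrow> 'a::complex_inner \<Rightarrow>\<^sub>L 'b::complex_inner) \<Rightarrow> complex set \<Rightarrow> bool" where
  "op_coanalytic_on F S \<longleftrightarrow> op_holomorphic_on (\<lambda>z. F (cnj z)) (cnj ` S)"

text \<open>
  \<open>\<Gamma>\<close> is a total function here; its values on the real line are irrelevant. Boundedness of the
  inverse of the bijection from \<open>\<K>\<close> onto the closed subspace \<open>orth_compl (rng_shift D T w)\<close> is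
  automatic by the open mapping theorem.
\<close>

definition is_model ::
  "'a::complex_inner set \<Rightarrow> ('a \<Rightarrow> 'a) \<Rightarrow> (complex \<Rightarrow> 'k::complex_inner \<Rightarrow>\<^sub>L 'a) \<Rightarrow> bool" where
  "is_model D T \<Gamma> \<longleftrightarrow>
     (\<forall>w. Im w \<noteq> 0 \<longrightarrow> clinear (blinfun_apply (\<Gamma> w))) \<and>
     op_coanalytic_on \<Gamma> {w. Im w \<noteq> 0} \<and>
     (\<forall>w. Im w \<noteq> 0 \<longrightarrow>
        bij_betw (blinfun_apply (\<Gamma> w)) UNIV (orth_compl (rng_shift D T w))) \<and>
     (\<forall>w z. (Im w > 0 \<and> Im z > 0) \<or> (Im w < 0 \<and> Im z < 0) \<longrightarrow>
        op_invertible (op_adjoint (\<Gamma> z) o\<^sub>L \<Gamma> w)) \<and>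
     closed_span (\<Union>w\<in>{w. Im w \<noteq> 0}. range (blinfun_apply (\<Gamma> w))) = UNIV"

text \<open>\<open>model_kernel \<Gamma> w z\<close> is $K_w(z)$.\<close>

definition model_kernel ::
  "(complex \<Rightarrow> 'k::complex_inner \<Rightarrow>\<^sub>L 'a::complex_inner) \<Rightarrow> complex \<Rightarrow> complex \<Rightarrow> 'k \<Rightarrow>\<^sub>L 'k" where
  "model_kernel \<Gamma> w z = op_adjoint (\<Gamma> z) o\<^sub>L \<Gamma> w"

definition model_Phi ::
  "(complex \<Rightarrow> 'k::complex_inner \<Rightarrow>\<^sub>L 'a::complex_inner) \<Rightarrow> complex \<Rightarrow> 'k \<Rightarrow>\<^sub>L 'k" where
  "model_Phi \<Gamma> z = model_kernel \<Gamma> \<i> z o\<^sub>L op_inverse (op_sqrt (model_kernel \<Gamma> \<i> \<i>))"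

definition model_Psi ::
  "(complex \<Rightarrow> 'k::complex_inner \<Rightarrow>\<^sub>L 'a::complex_inner) \<Rightarrow> complex \<Rightarrow> 'k \<Rightarrow>\<^sub>L 'k" where
  "model_Psi \<Gamma> z =
     model_kernel \<Gamma> (- \<i>) z o\<^sub>L op_inverse (op_sqrt (model_kernel \<Gamma> (- \<i>) (- \<i>)))"

definition model_V ::
  "(complex \<Rightarrow> 'k::complex_inner \<Rightarrow>\<^sub>L 'a::complex_inner) \<Rightarrow> complex \<Rightarrow> 'k \<Rightarrow>\<^sub>L 'k" where
  "model_V \<Gamma> z =
     ((z - \<i>) / (z + \<i>)) *\<^sub>C (op_inverse (model_Phi \<Gamma> z) o\<^sub>L model_Psi \<Gamma> z)"

end

theory Submission
  imports Defs
begin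

text \<open>
  Put \<open>b(z) = (z - \<i>) / (z + \<i>)\<close>. Since the Cayley transform of \<open>T\<close> is isometric, the kernel of
  a model satisfies
  \<open>(1 - b(w) cnj (b(z))) K\<^sub>z(w) = \<Phi>(w) \<Phi>(z)* - b(w) cnj (b(z)) \<Psi>(w) \<Psi>(z)*\<close>,
  so off the conjugate pairs \<open>w = cnj z\<close> it is determined by \<open>\<Phi>\<close> and \<open>\<Psi>\<close>, while for conjugate
  pairs the identity says \<open>\<Phi>(w) \<Phi>(z)* = \<Psi>(w) \<Psi>(z)*\<close> and carries the relation between \<open>V\<^sub>1\<close>
  and \<open>V\<^sub>2\<close> to the lower half plane. If \<open>V\<^sub>1 = R V\<^sub>2 Q\<close>, there are thus bijections \<open>C(z)\<close> of
  \<open>\<K>\<close> such that the vectors \<open>\<Gamma>\<^sub>1(z) k\<close> and \<open>\<Gamma>\<^sub>2(z) C(z) k\<close> have the same inner products as long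
  as conjugate pairs are avoided. They define a unitary, and it intertwines \<open>T\<^sub>1\<close> and
  \<open>T\<^sub>2\<close> because \<open>T x = y\<close> means that \<open>y - z x\<close> is orthogonal to the range of \<open>\<Gamma>(z)\<close> for all \<open>z\<close>.
  Conversely a unitary equivalence \<open>U\<close> maps the deficiency spaces onto each other, and
  \<open>R\<^sup>-\<^sup>1\<close>, \<open>Q\<close> are its matrices at \<open>\<plusminus> \<i>\<close> in the isometric coordinates \<open>\<Gamma>(\<plusminus> \<i>) K(\<plusminus> \<i>)^(- 1/2)\<close>.
\<close>

section \<open>Projections and adjoints\<close>

\<comment> \<open>Supplies the sort \<open>banach\<close> for the auxiliary space: the square roots
  below come from a fixed point argument, which needs its space of bounded operators to be
  complete.\<close>
subclass (in separable_hilbert_space) banach ..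

lemma cinner_add_right: "cinner x (y + z) = cinner x y + cinner x (z::'a::complex_inner)"
  by (metis cinner_add_left cinner_commute complex_cnj_add)

lemma cinner_scaleC_right: "cinner x (c *\<^sub>C y) = cnj c * cinner x (y::'a::complex_inner)"
  by (metis cinner_commute cinner_scaleC_left complex_cnj_mult)

text \<open>Reduces imaginary parts to the real inner product, so that real estimates such as
  Cauchy-Schwarz control both components.\<close>

lemma Im_cinner: "Im (cinner x y) = inner x (\<i> *\<^sub>C (y::'a::complex_inner))"
  by (simp add: inner_eq_Re_cinner cinner_scaleC_right)

lemma bounded_bilinear_cinner:
  "bounded_bilinear (cinner :: 'a::complex_inner \<Rightarrow> 'a \<Rightarrow> complex)"
proof
  fix a b :: 'a and r :: real
  show "cinner (r *\<^sub>R a) b = r *\<^sub>R cinner a b"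
    by (simp add: scaleR_scaleC cinner_scaleC_left scaleR_conv_of_real)
  show "cinner a (r *\<^sub>R b) = r *\<^sub>R cinner a b"
    by (simp add: scaleR_scaleC cinner_scaleC_right scaleR_conv_of_real)
  show "\<exists>K. \<forall>a b :: 'a. norm (cinner a b) \<le> norm a * norm b * K"
  proof (intro exI allI)
    fix a b :: 'a
    have "\<bar>inner a b\<bar> \<le> norm a * norm b" "\<bar>inner a (\<i> *\<^sub>C b)\<bar> \<le> norm a * norm b"
      using Cauchy_Schwarz_ineq2[of a b] Cauchy_Schwarz_ineq2[of a "\<i> *\<^sub>C b"]
      by (simp_all add: norm_scaleC)
    then show "norm (cinner a b) \<le> norm a * norm b * 2"
      using cmod_le[of "cinner a b"] by (simp add: Im_cinner inner_eq_Re_cinner[symmetric])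
  qed
qed (simp_all add: cinner_add_left cinner_add_right)

interpretation cinner: bounded_bilinear "cinner :: 'a::complex_inner \<Rightarrow> 'a \<Rightarrow> complex"
  by (rule bounded_bilinear_cinner)

lemma cinner_self: "cinner x x = complex_of_real ((norm (x::'a::complex_inner))\<^sup>2)"
proof -
  have "Im (cinner x x) = 0"
    using cinner_commute[of x x] by (simp add: complex_eq_iff)
  then show ?thesis
    by (simp add: complex_eq_iff inner_eq_Re_cinner[symmetric] power2_norm_eq_inner)
qed

lemma cinner_eqI:
  assumes "\<And>z. cinner z x = cinner z y"
  shows "x = (y::'a::complex_inner)"
proof -
  have "cinner (x - y) (x - y) = 0"
    using assms[of "x - y"] by (simp add: cinner.diff_right)
  then show ?thesis by (simp add: cinner_self)
qed

lemma cinner_eqI_left: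
  assumes "\<And>z. cinner x z = cinner y z"
  shows "x = (y::'a::complex_inner)"
  by (rule cinner_eqI) (metis assms cinner_commute)

text \<open>Complex linearity of \<open>f\<close> recovers the imaginary part of the pairing from
  the real one, because Im c = - Re (\<i> c).\<close>

lemma cinner_eq_if_inner_eq:
  fixes f :: "'a::complex_inner \<Rightarrow> 'b::complex_inner" and g :: "'b \<Rightarrow> 'a"
  assumes "\<And>x y. inner (f x) y = inner x (g y)"
  assumes f: "clinear f"
  shows "cinner (f x) y = cinner x (g y)"
proof (rule complex_eqI)
  show "Re (cinner (f x) y) = Re (cinner x (g y))"
    using assms(1) by (simp add: inner_eq_Re_cinner)
  have "Im (cinner (f x) y) = - Re (cinner (\<i> *\<^sub>C f x) y)"
    by (simp add: cinner_scaleC_left)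
  also have "\<dots> = - inner (f (\<i> *\<^sub>C x)) y"
    using f by (simp add: Vector_Spaces.linear_iff inner_eq_Re_cinner)
  also have "\<dots> = - Re (cinner (\<i> *\<^sub>C x) (g y))"
    using assms(1) by (simp add: inner_eq_Re_cinner)
  also have "\<dots> = Im (cinner x (g y))"
    by (simp add: cinner_scaleC_left)
  finally show "Im (cinner (f x) y) = Im (cinner x (g y))" .
qed

text \<open>A minimizing sequence for the distance from \<open>x\<close> to \<open>S\<close> is
  Cauchy, and its limit is the foot of the perpendicular.\<close>

lemma closed_subspace_projection:
  fixes S :: "'a::{real_inner,complete_space} set"
  assumes "closed S" "subspace S"
  obtains s where "s \<in> S" "\<forall>y\<in>S. inner (x - s) y = 0"
proof -
  define D where "D = (INF s\<in>S. (norm (x - s))\<^sup>2)"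
  have S0: "0 \<in> S" using assms(2) by (rule subspace_0)
  have bdd: "bdd_below ((\<lambda>s. (norm (x - s))\<^sup>2) ` S)"
    by (rule bdd_belowI[of _ 0]) auto
  have lower: "D \<le> (norm (x - s))\<^sup>2" if "s \<in> S" for s
    unfolding D_def using bdd that by (rule cINF_lower)
  have "\<exists>s\<in>S. (norm (x - s))\<^sup>2 < D + 1 / Suc n" for n
  proof -
    have "D < D + 1 / Suc n" by simp
    then show ?thesis
      unfolding D_def using S0 by (subst (asm) cINF_less_iff) (use bdd in auto)
  qed
  then obtain s where sS: "s n \<in> S" and s: "(norm (x - s n))\<^sup>2 < D + 1 / Suc n" for n
    by metis
  \<comment> \<open>Parallelogram law; the midpoint of \<open>s m\<close> and \<open>s n\<close>
    lies in \<open>S\<close>, so its squared distance from \<open>x\<close> is at least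
    \<open>D\<close>.\<close>
  have close: "(norm (s m - s n))\<^sup>2 < 2 / Suc m + 2 / Suc n" for m n
  proof -
    have "(norm (s m - s n))\<^sup>2 = 2 * (norm (x - s m))\<^sup>2 + 2 * (norm (x - s n))\<^sup>2
        - 4 * (norm (x - (1/2) *\<^sub>R (s m + s n)))\<^sup>2"
      by (simp add: power2_norm_eq_inner inner_diff inner_add inner_commute algebra_simps)
    moreover have "D \<le> (norm (x - (1/2) *\<^sub>R (s m + s n)))\<^sup>2"
      using assms(2) sS by (intro lower subspace_scale subspace_add) auto
    ultimately show ?thesis using s[of m] s[of n] by simp
  qed
  have "Cauchy s"
  proof (rule metric_CauchyI)
    fix e :: real assume "e > 0"
    then obtain N where N: "1 / Suc N < e\<^sup>2 / 4"
      using reals_Archimedean[of "e\<^sup>2 / 4"] by (auto simp: inverse_eq_divide)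
    have "dist (s m) (s n) < e" if "m \<ge> N" "n \<ge> N" for m n
    proof -
      have "2 / Suc m \<le> 2 / Suc N" "2 / Suc n \<le> 2 / Suc N"
        using that by (simp_all add: frac_le)
      then have "(norm (s m - s n))\<^sup>2 < e\<^sup>2" using close[of m n] N by simp
      then show ?thesis using \<open>e > 0\<close> by (simp add: dist_norm power_less_imp_less_base)
    qed
    then show "\<exists>M. \<forall>m\<ge>M. \<forall>n\<ge>M. dist (s m) (s n) < e" by blast
  qed
  then obtain t where t: "s \<longlonglongrightarrow> t"
    using Cauchy_convergent convergent_def by blast
  have tS: "t \<in> S" using assms(1) sS t by (rule closed_sequentially)
  have "(norm (x - t))\<^sup>2 \<le> D"
  proof (rule LIMSEQ_le)
    show "(\<lambda>n. (norm (x - s n))\<^sup>2) \<longlonglongrightarrow> (norm (x - t))\<^sup>2"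
      by (intro tendsto_intros t)
    show "(\<lambda>n. D + 1 / Suc n) \<longlonglongrightarrow> D"
      using tendsto_add[OF tendsto_const LIMSEQ_inverse_real_of_nat, of D]
      by (simp add: inverse_eq_divide)
    show "\<exists>N. \<forall>n\<ge>N. (norm (x - s n))\<^sup>2 \<le> D + 1 / Suc n"
      using s less_imp_le by blast
  qed
  have "inner (x - t) y = 0" if "y \<in> S" for y
  proof (cases "y = 0")
    case False
    \<comment> \<open>With this coefficient \<open>r *\<^sub>R y\<close> is the component of
      \<open>x - t\<close> along \<open>y\<close>; removing it would shorten \<open>x - t\<close>
      unless it is zero.\<close>
    define r where "r = inner (x - t) y / (norm y)\<^sup>2"
    have "(norm (x - t))\<^sup>2 \<le> (norm (x - (t + r *\<^sub>R y)))\<^sup>2"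
      by (rule order_trans[OF \<open>_ \<le> D\<close> lower])
        (use assms(2) tS that in \<open>simp add: subspace_add subspace_scale\<close>)
    also have "x - (t + r *\<^sub>R y) = (x - t) - r *\<^sub>R y" by simp
    also have "(norm ((x - t) - r *\<^sub>R y))\<^sup>2
        = (norm (x - t))\<^sup>2 - 2 * r * inner (x - t) y + r\<^sup>2 * (norm y)\<^sup>2"
      unfolding power2_norm_eq_inner by (simp add: inner_commute power2_eq_square algebra_simps)
    finally have "2 * r * inner (x - t) y \<le> r\<^sup>2 * (norm y)\<^sup>2" by simp
    moreover have "inner (x - t) y = r * (norm y)\<^sup>2" using False by (simp add: r_def)
    ultimately have "r\<^sup>2 * (norm y)\<^sup>2 \<le> 0" by (simp add: power2_eq_square algebra_simps)
    then have "r = 0" using False by (simp add: mult_le_0_iff)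
    then show ?thesis using \<open>inner (x - t) y = r * _\<close> by simp
  qed simp
  then show ?thesis using tS that by blast
qed

lemma riesz_representation:
  fixes f :: "'a::{real_inner,complete_space} \<Rightarrow> real"
  assumes f: "bounded_linear f"
  obtains y where "\<And>x. f x = inner x y"
proof (cases "\<forall>x. f x = 0")
  case True
  then show ?thesis using that[of 0] by simp
next
  case False
  interpret f: bounded_linear f by (rule f)
  obtain x where x: "f x \<noteq> 0" using False by blast
  let ?S = "{x. f x = 0}"
  have "closed ?S"
    by (intro closed_Collect_eq continuous_intros f.continuous_on)
  moreover have "subspace ?S"
    by (auto simp: subspace_def f.add f.scaleR f.zero)
  ultimately obtain s where "s \<in> ?S" and "\<forall>y\<in>?S. inner (x - s) y = 0"
    by (rule closed_subspace_projection[of ?S x])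
  then have s: "f s = 0" "\<And>y. f y = 0 \<Longrightarrow> inner (x - s) y = 0" by simp_all
  define u where "u = x - s"
  have fu: "f u \<noteq> 0" using x s by (simp add: u_def f.diff)
  then have u: "u \<noteq> 0" using f.zero by auto
  \<comment> \<open>Since \<open>u\<close> is orthogonal to the kernel of \<open>f\<close>,
    subtracting the multiple of \<open>u\<close> that brings \<open>y\<close> into the kernel
    determines the inner product of \<open>y\<close> with \<open>u\<close>.\<close>
  have "f y = inner y ((f u / inner u u) *\<^sub>R u)" for y
  proof -
    have "inner u (y - (f y / f u) *\<^sub>R u) = 0"
      unfolding u_def by (rule s) (use fu in \<open>simp add: u_def f.diff f.scaleR\<close>)
    then show ?thesis using fu u by (simp add: inner_diff_right inner_commute field_simps)
  qed
  then show ?thesis using that by blast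
qed

lemma clinearI:
  assumes "\<And>x y. f (x + y) = f x + f y" "\<And>c x. f (c *\<^sub>C x) = c *\<^sub>C f x"
  shows "clinear f"
  by (simp add: Vector_Spaces.linear_iff assms complex_vector.vector_space_axioms)

lemma clinear_add: "clinear f \<Longrightarrow> f (x + y) = f x + f y"
  and clinear_scaleC: "clinear f \<Longrightarrow> f (c *\<^sub>C x) = c *\<^sub>C f x"
  by (simp_all add: Vector_Spaces.linear_iff)

lemma clinear_blinfun_compose:
  "clinear (blinfun_apply A) \<Longrightarrow> clinear (blinfun_apply B) \<Longrightarrow> clinear (blinfun_apply (A o\<^sub>L B))"
  by (rule clinearI) (simp_all add: clinear_add clinear_scaleC)

text \<open>Riesz representation of each functional \<open>\<lambda>x. inner (A x) y\<close> yields
  the real adjoint; complex linearity of \<open>A\<close> makes it the complex one.\<close>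

lemma adjoint_exists:
  fixes A :: "'a::{complex_inner,complete_space} \<Rightarrow>\<^sub>L 'b::complex_inner"
  assumes A: "clinear (blinfun_apply A)"
  shows "\<exists>B :: 'b \<Rightarrow>\<^sub>L 'a. \<forall>x y. cinner (A x) y = cinner x (B y)"
proof -
  have "\<exists>z. \<forall>x. inner (A x) y = inner x z" for y
  proof -
    have "bounded_linear (\<lambda>x. inner (A x) y)"
      by (intro bounded_linear_inner_left_comp blinfun.bounded_linear_right)
    then show ?thesis using riesz_representation by metis
  qed
  then obtain b where b: "inner (A x) y = inner x (b y)" for x y by metis
  have "bounded_linear b"
  proof (rule bounded_linear_intro[where K = "norm A"])
    fix x y :: 'b and r :: real
    show "b (x + y) = b x + b y" "b (r *\<^sub>R x) = r *\<^sub>R b x"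
      by (rule inner_eq_zero_iff[THEN iffD1, THEN eq_iff_diff_eq_0[THEN iffD2]],
          simp add: inner_diff_right inner_add_right b[symmetric])+
    have "(norm (b x))\<^sup>2 = inner (A (b x)) x" by (simp add: power2_norm_eq_inner b)
    also have "\<dots> \<le> norm (A (b x)) * norm x" by (rule norm_cauchy_schwarz)
    also have "\<dots> \<le> norm A * norm (b x) * norm x"
      by (intro mult_right_mono norm_blinfun) simp
    finally show "norm (b x) \<le> norm x * norm A"
      by (cases "norm (b x) = 0") (simp_all add: power2_eq_square mult_ac)
  qed
  then have "inner (A x) y = inner x (Blinfun b y)" for x y
    using b by (simp add: bounded_linear_Blinfun_apply)
  then show ?thesis using cinner_eq_if_inner_eq[OF _ A] by blast
qed

lemma cinner_adjoint:
  fixes A :: "'a::{complex_inner,complete_space} \<Rightarrow>\<^sub>L 'b::complex_inner"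
  assumes A: "clinear (blinfun_apply A)"
  shows "cinner (A x) y = cinner x (op_adjoint A y)"
proof -
  obtain B where B: "\<forall>x y. cinner (A x) y = cinner x (blinfun_apply B y)"
    using adjoint_exists[OF A] by blast
  have "op_adjoint A = B"
    unfolding op_adjoint_def
  proof (rule the_equality)
    show "\<forall>x y. cinner (A x) y = cinner x (B y)" by (rule B)
    fix C assume "\<forall>x y. cinner (A x) y = cinner x (blinfun_apply C y)"
    then show "C = B" using B by (intro blinfun_eqI cinner_eqI) metis
  qed
  then show ?thesis using B by simp
qed

lemma cinner_adjoint_left:
  fixes A :: "'a::{complex_inner,complete_space} \<Rightarrow>\<^sub>L 'b::complex_inner"
  assumes "clinear (blinfun_apply A)"
  shows "cinner (op_adjoint A x) y = cinner x (A y)"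
  by (metis assms cinner_adjoint cinner_commute)

lemma clinear_adjoint:
  fixes A :: "'a::{complex_inner,complete_space} \<Rightarrow>\<^sub>L 'b::complex_inner"
  assumes "clinear (blinfun_apply A)"
  shows "clinear (blinfun_apply (op_adjoint A))"
  by (intro clinearI cinner_eqI_left)
    (simp_all add: cinner_adjoint_left[OF assms] cinner_add_left cinner_scaleC_left)

section \<open>Positive square roots\<close>

definition hermitian :: "'a::complex_inner \<Rightarrow>\<^sub>L 'a \<Rightarrow> bool" where
  "hermitian A \<longleftrightarrow> (\<forall>x y. cinner (A x) y = cinner x (A y))"

definition coercive :: "'a::complex_inner \<Rightarrow>\<^sub>L 'a \<Rightarrow> bool" where
  "coercive A \<longleftrightarrow> (\<exists>e>0. \<forall>x. e * (norm x)\<^sup>2 \<le> Re (cinner (A x) x))"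

lemma clinear_diff: "clinear f \<Longrightarrow> f (x - y) = f x - f y"
  using clinear_add[of f "x - y" y] by (simp add: eq_diff_eq)

lemma scaleC_scaleR: "c *\<^sub>C (r *\<^sub>R x) = r *\<^sub>R (c *\<^sub>C (x::'a::complex_vector))"
  by (simp add: scaleR_scaleC scaleC_scaleC mult.commute)

lemma scaleC_diff_right: "c *\<^sub>C (x - y) = c *\<^sub>C x - c *\<^sub>C (y::'a::complex_vector)"
  by (rule complex_vector.scale_right_diff_distrib)

text \<open>The set in which the fixed point for the square root is sought. Commutation with
  everything that commutes with \<open>A\<close> is carried along because uniqueness of the root
  depends on it.\<close>

lemma closed_commuting_hermitian:
  fixes A :: "'a::{complex_inner,banach} \<Rightarrow>\<^sub>L 'a"
  shows "closed {Y. norm Y \<le> r \<and> clinear (blinfun_apply Y) \<and> hermitian Y \<and>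
    (\<forall>B. B o\<^sub>L A = A o\<^sub>L B \<longrightarrow> B o\<^sub>L Y = Y o\<^sub>L B)}"
proof -
  \<comment> \<open>Bounded operators are additive already, so complex linearity becomes a family of
    equations between continuous functions of \<open>Y\<close>.\<close>
  have c: "clinear (blinfun_apply Y) \<longleftrightarrow> (\<forall>c x. Y (c *\<^sub>C x) = c *\<^sub>C Y x)" for Y :: "'a \<Rightarrow>\<^sub>L 'a"
    by (auto intro: clinearI simp: clinear_scaleC blinfun.add_right)
  have ap: "continuous_on UNIV (\<lambda>Y :: 'a \<Rightarrow>\<^sub>L 'a. blinfun_apply Y x)" for x
    by (intro continuous_intros)
  have sc: "continuous_on UNIV (\<lambda>Y :: 'a \<Rightarrow>\<^sub>L 'a. c *\<^sub>C Y x)" for c x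
    by (rule bounded_linear.continuous_on[OF bounded_linear_scaleC ap])
  have co: "continuous_on UNIV (\<lambda>Y :: 'a \<Rightarrow>\<^sub>L 'a. B o\<^sub>L Y)"
    "continuous_on UNIV (\<lambda>Y :: 'a \<Rightarrow>\<^sub>L 'a. Y o\<^sub>L B)" for B :: "'a \<Rightarrow>\<^sub>L 'a"
    by (intro bounded_bilinear.continuous_on[OF bounded_bilinear_blinfun_compose] continuous_intros)+
  have ip: "continuous_on UNIV (\<lambda>Y :: 'a \<Rightarrow>\<^sub>L 'a. cinner (Y x) y)"
    "continuous_on UNIV (\<lambda>Y :: 'a \<Rightarrow>\<^sub>L 'a. cinner x (Y y))" for x y
    by (intro cinner.continuous_on ap continuous_on_const)+
  show ?thesis
    unfolding c hermitian_def
    by (intro closed_Collect_conj closed_Collect_all closed_Collect_imp open_Collect_const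
        closed_Collect_eq closed_Collect_le ap sc co ip continuous_intros)
qed

text \<open>
  Write \<open>A = c (1 - X)\<close> with \<open>\<parallel>X\<parallel> < 1\<close>. The root is \<open>sqrt c (1 - Y)\<close> where \<open>Y\<close> is
  the fixed point of the contraction \<open>Y \<mapsto> (X + Y\<^sup>2) / 2\<close>.
\<close>

lemma coercive_sqrt_exists:
  fixes A :: "'a::{complex_inner,banach} \<Rightarrow>\<^sub>L 'a"
  assumes A: "clinear (blinfun_apply A)" "hermitian A" "coercive A"
  obtains S where "clinear (blinfun_apply S)" "hermitian S" "coercive S" "S o\<^sub>L S = A"
    "\<forall>B. B o\<^sub>L A = A o\<^sub>L B \<longrightarrow> B o\<^sub>L S = S o\<^sub>L B"
proof -
  obtain e where e: "e > 0" "\<And>x. e * (norm x)\<^sup>2 \<le> Re (cinner (A x) x)"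
    using A(3) by (auto simp: coercive_def)
  \<comment> \<open>The bound for \<open>X\<close> is \<parallel>X\<parallel>^2 \<le> 1 - 2 e/c +
    \<parallel>A\<parallel>^2/c^2. As \<parallel>A\<parallel>^2 \<le> e c, this is at most 1 - e/c;
    the remaining summands give e < c, so that this number is positive.\<close>
  define c where "c = ((norm A)\<^sup>2 + 1 + e\<^sup>2) / e"
  have ec: "e * c = (norm A)\<^sup>2 + 1 + e\<^sup>2" using e by (simp add: c_def)
  have c0: "c > 0" unfolding c_def by (intro divide_pos_pos add_nonneg_pos e) (use e in auto)
  have ec1: "e / c < 1"
  proof -
    have "e * e < e * c" unfolding ec by (simp add: power2_eq_square add_nonneg_pos)
    then show ?thesis using e c0 by simp
  qed
  define r where "r = sqrt (1 - e / c)"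
  have r: "0 \<le> r" "r < 1" "r\<^sup>2 = 1 - e / c" using ec1 e c0 by (auto simp: r_def)
  define X where "X = id_blinfun - (1 / c) *\<^sub>R A"
  have Xx: "X x = x - (1 / c) *\<^sub>R A x" for x by (simp add: X_def blinfun.diff_left blinfun.scaleR_left)
  have "norm (X x) \<le> r * norm x" for x
  proof (rule power2_le_imp_le)
    have "(norm (X x))\<^sup>2 = (norm x)\<^sup>2 - (2 / c) * inner (A x) x + (norm (A x))\<^sup>2 / c\<^sup>2"
      unfolding power2_norm_eq_inner Xx
      by (simp add: inner_diff inner_commute power2_eq_square algebra_simps)
    also have "\<dots> \<le> (norm x)\<^sup>2 - (2 / c) * (e * (norm x)\<^sup>2) + ((norm A)\<^sup>2 * (norm x)\<^sup>2) / c\<^sup>2"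
    proof (intro add_mono diff_mono mult_left_mono divide_right_mono)
      show "(norm (A x))\<^sup>2 \<le> (norm A)\<^sup>2 * (norm x)\<^sup>2"
        using power_mono[OF norm_blinfun[of A x], of 2] by (simp add: power_mult_distrib)
    qed (use e(2)[of x] c0 in \<open>auto simp: inner_eq_Re_cinner\<close>)
    also have "\<dots> \<le> (norm x)\<^sup>2 - (2 / c) * (e * (norm x)\<^sup>2) + (e * c * (norm x)\<^sup>2) / c\<^sup>2"
      unfolding ec by (intro add_mono order_refl divide_right_mono mult_right_mono) auto
    also have "\<dots> = (r * norm x)\<^sup>2"
      unfolding power_mult_distrib r(3) using c0 by (simp add: power2_eq_square field_simps)
    finally show "(norm (X x))\<^sup>2 \<le> (r * norm x)\<^sup>2" .
  qed (use r in simp)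
  then have normX: "norm X \<le> r" by (intro norm_blinfun_bound r)
  define M where "M = {Y. norm Y \<le> r \<and> clinear (blinfun_apply Y) \<and> hermitian Y \<and>
    (\<forall>B. B o\<^sub>L A = A o\<^sub>L B \<longrightarrow> B o\<^sub>L Y = Y o\<^sub>L B)}"
  define f where "f Y = (1/2) *\<^sub>R (X + (Y o\<^sub>L Y))" for Y :: "'a \<Rightarrow>\<^sub>L 'a"
  have fx: "f Y x = (1/2) *\<^sub>R (X x + Y (Y x))" for Y x
    by (simp add: f_def blinfun.add_left blinfun.scaleR_left)
  have "\<exists>!Y\<in>M. f Y = Y"
  proof (rule Banach_fix)
    show "complete M"
      unfolding M_def complete_eq_closed by (rule closed_commuting_hermitian)
    have "(0 :: 'a \<Rightarrow>\<^sub>L 'a) \<in> M"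
      using r by (auto simp: M_def hermitian_def cinner.zero_left cinner.zero_right intro!: clinearI blinfun_eqI)
    then show "M \<noteq> {}" by blast
    show "f ` M \<subseteq> M"
    proof clarify
      fix Y assume "Y \<in> M"
      then have Y: "norm Y \<le> r" "clinear (blinfun_apply Y)"
        "\<And>x y. cinner (Y x) y = cinner x (Y y)"
        "\<And>B. B o\<^sub>L A = A o\<^sub>L B \<Longrightarrow> B o\<^sub>L Y = Y o\<^sub>L B"
        by (auto simp: M_def hermitian_def)
      have "norm (Y o\<^sub>L Y) \<le> 1 * r"
        by (rule order_trans[OF norm_blinfun_compose]) (use Y(1) r in \<open>intro mult_mono; auto\<close>)
      then have "norm (X + (Y o\<^sub>L Y)) \<le> r + r"
        using normX norm_triangle_ineq[of X "Y o\<^sub>L Y"] by linarith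
      then have "norm (f Y) \<le> r" by (simp add: f_def)
      moreover have "clinear (blinfun_apply (f Y))"
        using A(1) Y(2) by (intro clinearI)
          (simp_all add: fx Xx clinear_add clinear_scaleC scaleC_add_right scaleC_diff_right
            scaleC_scaleR algebra_simps)
      moreover have "hermitian (f Y)"
        using A(2) Y(3)
        by (simp add: hermitian_def fx Xx cinner.add_left cinner.add_right cinner.diff_left
            cinner.diff_right cinner.scaleR_left cinner.scaleR_right)
      moreover have "B o\<^sub>L f Y = f Y o\<^sub>L B" if B: "B o\<^sub>L A = A o\<^sub>L B" for B
      proof (rule blinfun_eqI)
        fix x
        have "B (A y) = A (B y)" "B (Y y) = Y (B y)" for y
          using B Y(4)[OF B] by (metis blinfun_apply_blinfun_compose)+
        then show "(B o\<^sub>L f Y) x = (f Y o\<^sub>L B) x"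
          by (simp add: fx Xx blinfun.add_right blinfun.diff_right blinfun.scaleR_right)
      qed
      ultimately show "f Y \<in> M" by (simp add: M_def)
    qed
    show "dist (f Y) (f Z) \<le> r * dist Y Z" if "Y \<in> M" "Z \<in> M" for Y Z
    proof -
      \<comment> \<open>Difference of squares without commutativity: Y^2 - Z^2 = Y (Y - Z) + (Y - Z)
        Z. Both factors outside the differences have norm at most \<open>r\<close>.\<close>
      have "f Y - f Z = (1/2) *\<^sub>R ((Y o\<^sub>L (Y - Z)) + ((Y - Z) o\<^sub>L Z))"
        by (rule blinfun_eqI)
          (simp add: fx blinfun.add_left blinfun.diff_left blinfun.scaleR_left blinfun.diff_right
            algebra_simps)
      then have "2 * norm (f Y - f Z) = norm ((Y o\<^sub>L (Y - Z)) + ((Y - Z) o\<^sub>L Z))" by simp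
      also have "\<dots> \<le> norm (Y o\<^sub>L (Y - Z)) + norm ((Y - Z) o\<^sub>L Z)" by (rule norm_triangle_ineq)
      also have "\<dots> \<le> norm Y * norm (Y - Z) + norm (Y - Z) * norm Z"
        by (intro add_mono norm_blinfun_compose)
      also have "\<dots> \<le> r * norm (Y - Z) + norm (Y - Z) * r"
        using that by (intro add_mono mult_mono) (auto simp: M_def r)
      finally show ?thesis by (simp add: dist_norm)
    qed
  qed (use r in auto)
  then obtain Y where "Y \<in> M" and fY: "f Y = Y" by blast
  then have Y: "norm Y \<le> r" "clinear (blinfun_apply Y)"
      "\<And>x y. cinner (Y x) y = cinner x (Y y)" "\<And>B. B o\<^sub>L A = A o\<^sub>L B \<Longrightarrow> B o\<^sub>L Y = Y o\<^sub>L B"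
    by (auto simp: M_def hermitian_def)
  define S where "S = sqrt c *\<^sub>R (id_blinfun - Y)"
  have Sx: "S x = sqrt c *\<^sub>R (x - Y x)" for x
    by (simp add: S_def blinfun.diff_left blinfun.scaleR_left)
  show ?thesis
  proof
    show "clinear (blinfun_apply S)"
      using Y(2) by (intro clinearI)
        (simp_all add: Sx clinear_add clinear_scaleC scaleC_diff_right scaleC_scaleR algebra_simps)
    show "hermitian S"
      using Y(3) by (simp add: hermitian_def Sx cinner.diff_left cinner.diff_right
          cinner.scaleR_left cinner.scaleR_right)
    show "coercive S"
      unfolding coercive_def
    proof (intro exI conjI allI)
      show "sqrt c * (1 - r) > 0" using c0 r by simp
      fix x
      have "inner (Y x) x \<le> norm (Y x) * norm x" by (rule norm_cauchy_schwarz)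
      also have "\<dots> \<le> r * norm x * norm x"
        by (intro mult_right_mono order_trans[OF norm_blinfun] Y(1)) simp_all
      finally have "(1 - r) * (norm x)\<^sup>2 \<le> inner (x - Y x) x"
        by (simp add: inner_diff power2_norm_eq_inner[symmetric] power2_eq_square algebra_simps)
      then have "sqrt c * ((1 - r) * (norm x)\<^sup>2) \<le> sqrt c * inner (x - Y x) x"
        using c0 by (intro mult_left_mono) auto
      then show "sqrt c * (1 - r) * (norm x)\<^sup>2 \<le> Re (cinner (S x) x)"
        by (simp add: Sx inner_eq_Re_cinner[symmetric] mult.assoc)
    qed
    show "S o\<^sub>L S = A"
    proof (rule blinfun_eqI)
      fix x
      \<comment> \<open>The fixed point equation 2 Y = X + Y^2 rearranges to (1 - Y)^2 = 1 - X =
        A/c.\<close>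
      have "X x + Y (Y x) = 2 *\<^sub>R f Y x" by (simp add: fx)
      then have "X x + Y (Y x) = 2 *\<^sub>R Y x" unfolding fY .
      then have "x - 2 *\<^sub>R Y x + Y (Y x) = (1 / c) *\<^sub>R A x" by (simp add: Xx algebra_simps)
      moreover have "(S o\<^sub>L S) x = c *\<^sub>R (x - 2 *\<^sub>R Y x + Y (Y x))"
        using c0 by (simp add: Sx blinfun.diff_right blinfun.scaleR_right scaleR_2
            scaleR_diff_right[symmetric] del: scaleR_diff_right)
      ultimately show "(S o\<^sub>L S) x = A x" using c0 by simp
    qed
    show "\<forall>B. B o\<^sub>L A = A o\<^sub>L B \<longrightarrow> B o\<^sub>L S = S o\<^sub>L B"
    proof (intro allI impI blinfun_eqI)
      fix B x assume "B o\<^sub>L A = A o\<^sub>L B"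
      then have "B (Y x) = Y (B x)"
        using Y(4) by (metis blinfun_apply_blinfun_compose)
      then show "(B o\<^sub>L S) x = (S o\<^sub>L B) x"
        by (simp add: Sx blinfun.diff_right blinfun.scaleR_right)
    qed
  qed
qed

text \<open>Justifies the definite description: the root constructed above is positive, and any
  positive root coincides with it.\<close>

lemma op_sqrt_coercive:
  fixes A :: "'a::{complex_inner,banach} \<Rightarrow>\<^sub>L 'a"
  assumes A: "clinear (blinfun_apply A)" "hermitian A" "coercive A"
  shows "clinear (blinfun_apply (op_sqrt A))" "hermitian (op_sqrt A)"
    "op_sqrt A o\<^sub>L op_sqrt A = A"
proof -
  obtain S where S: "clinear (blinfun_apply S)" "hermitian S" "coercive S" "S o\<^sub>L S = A"
    "\<forall>B. B o\<^sub>L A = A o\<^sub>L B \<longrightarrow> B o\<^sub>L S = S o\<^sub>L B"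
    using coercive_sqrt_exists[OF A] by metis
  obtain e where e: "e > 0" "\<And>x. e * (norm x)\<^sup>2 \<le> Re (cinner (S x) x)"
    using S(3) by (auto simp: coercive_def)
  have "op_sqrt A = S"
    unfolding op_sqrt_def
  proof (rule the_equality)
    have "cinner (S x) x \<in> \<real>\<^sub>\<ge>\<^sub>0" for x
    proof -
      have "cinner (S x) x = cnj (cinner (S x) x)"
        using S(2) by (metis hermitian_def cinner_commute)
      moreover have "0 \<le> Re (cinner (S x) x)"
        using e order_trans[OF _ e(2)] by (meson less_imp_le mult_nonneg_nonneg zero_le_power2)
      ultimately show ?thesis by (simp add: complex_nonneg_Reals_iff complex_eq_iff)
    qed
    then show "op_positive S \<and> S o\<^sub>L S = A" using S(1,4) by (simp add: op_positive_def)
  next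
    fix B assume B: "op_positive B \<and> B o\<^sub>L B = A"
    \<comment> \<open>\<open>B\<close> commutes with its square \<open>A\<close>, hence with
      \<open>S\<close> by the commutation property of the constructed root.\<close>
    then have "A = B o\<^sub>L B" by simp
    then have BB: "A x = B (B x)" for x by simp
    have "B o\<^sub>L A = A o\<^sub>L B"
      by (rule blinfun_eqI) (simp add: BB)
    then have "B o\<^sub>L S = S o\<^sub>L B" using S(5) by blast
    then have comm: "B (S x) = S (B x)" for x
      by (metis blinfun_apply_blinfun_compose)
    show "B = S"
    proof (rule blinfun_eqI)
      fix x
      \<comment> \<open>Since B^2 = S^2 and the two commute, (B + S) (B - S) = 0. Positivity of
        \<open>B\<close> and coercivity of \<open>S\<close> then force \<open>y = 0\<close>.\<close>
      define y where "y = B x - S x"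
      have "B (B x) = S (S x)"
        unfolding BB[symmetric] S(4)[symmetric] by simp
      then have "B y + S y = 0" by (simp add: y_def blinfun.diff_right comm)
      then have "Re (cinner (B y) y) + Re (cinner (S y) y) = 0"
        by (metis cinner.add_left cinner.zero_left plus_complex.sel(1) zero_complex.sel(1))
      moreover have "0 \<le> Re (cinner (B y) y)"
        using B by (auto simp: op_positive_def complex_nonneg_Reals_iff)
      ultimately have "Re (cinner (S y) y) \<le> 0" by linarith
      then have "e * (norm y)\<^sup>2 \<le> 0" using e(2)[of y] by linarith
      then have "y = 0" using e(1) by (simp add: mult_le_0_iff)
      then show "B x = S x" by (simp add: y_def)
    qed
  qed
  then show "clinear (blinfun_apply (op_sqrt A))" "hermitian (op_sqrt A)"
    "op_sqrt A o\<^sub>L op_sqrt A = A" using S(1,2,4) by simp_all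
qed

section \<open>Inverses and isometric normalization of operators\<close>

lemma op_inverse:
  assumes "op_invertible A"
  shows "A (op_inverse A x) = x" "op_inverse A (A x) = x"
proof -
  obtain B where B: "A o\<^sub>L B = id_blinfun" "B o\<^sub>L A = id_blinfun"
    using assms by (auto simp: op_invertible_def)
  have "op_inverse A = B"
    unfolding op_inverse_def
  proof (rule the_equality)
    fix C assume "A o\<^sub>L C = id_blinfun \<and> C o\<^sub>L A = id_blinfun"
    then show "C = B"
      using B by (intro blinfun_eqI) (metis blinfun_apply_blinfun_compose blinfun_apply_id_blinfun id_apply)
  qed (use B in simp)
  then show "A (op_inverse A x) = x" "op_inverse A (A x) = x"
    using B by (metis blinfun_apply_blinfun_compose blinfun_apply_id_blinfun id_apply)+
qed

lemma op_invertible_bij: "op_invertible A \<Longrightarrow> bij (blinfun_apply A)"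
  by (rule bijI') (metis op_inverse)+

lemma op_invertible_compose:
  assumes "op_invertible A" "op_invertible B"
  shows "op_invertible (A o\<^sub>L B)"
  unfolding op_invertible_def
  by (rule exI[of _ "op_inverse B o\<^sub>L op_inverse A"])
    (auto intro!: blinfun_eqI simp: op_inverse assms)

lemma op_invertible_inverse: "op_invertible A \<Longrightarrow> op_invertible (op_inverse A)"
  unfolding op_invertible_def[of "op_inverse A"]
  by (rule exI[of _ A]) (auto intro!: blinfun_eqI simp: op_inverse)

lemma clinear_op_inverse:
  assumes "op_invertible A" "clinear (blinfun_apply A)"
  shows "clinear (blinfun_apply (op_inverse A))"
proof (rule clinearI)
  show "op_inverse A (c *\<^sub>C x) = c *\<^sub>C op_inverse A x" for c x
    by (metis assms op_inverse clinear_scaleC)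
qed (rule blinfun.add_right)

text \<open>With A = \<open>op_adjoint G o\<^sub>L G\<close>, \<open>h\<close> is A^(- 1/2), so that
  G h is isometric. The root exists because \<open>G\<close> has a bounded left inverse, which makes
  A coercive.\<close>

lemma whitening:
  fixes G :: "'k::{complex_inner,banach} \<Rightarrow>\<^sub>L 'a::{complex_inner,complete_space}"
  assumes G: "clinear (blinfun_apply G)" and inv: "op_invertible (op_adjoint G o\<^sub>L G)"
  defines "h \<equiv> op_inverse (op_sqrt (op_adjoint G o\<^sub>L G))"
  shows "clinear (blinfun_apply h)" "hermitian h" "op_invertible h"
    "cinner (G (h x)) (G (h y)) = cinner x y"
proof -
  let ?A = "op_adjoint G o\<^sub>L G"
  have A1: "clinear (blinfun_apply ?A)"
    by (intro clinear_blinfun_compose clinear_adjoint G)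
  have A2: "hermitian ?A"
    by (simp add: hermitian_def cinner_adjoint[OF G, symmetric] cinner_adjoint_left[OF G])
  let ?m = "norm (op_inverse ?A o\<^sub>L op_adjoint G) + 1"
  have A3: "coercive ?A"
    unfolding coercive_def
  proof (intro exI conjI allI)
    have m0: "?m > 0" by (rule add_nonneg_pos) auto
    then show "1 / ?m\<^sup>2 > 0" by simp
    fix x
    have "norm x = norm ((op_inverse ?A o\<^sub>L op_adjoint G) (G x))"
      using op_inverse(2)[OF inv, of x] by simp
    also have "\<dots> \<le> ?m * norm (G x)"
      by (rule order_trans[OF norm_blinfun]) (simp add: mult_right_mono)
    finally have "(norm x)\<^sup>2 \<le> ?m\<^sup>2 * (norm (G x))\<^sup>2"
      by (metis power_mono norm_ge_zero power_mult_distrib)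
    then have "1 / ?m\<^sup>2 * (norm x)\<^sup>2 \<le> (norm (G x))\<^sup>2"
      using m0 by (simp add: divide_le_eq mult.commute)
    then show "1 / ?m\<^sup>2 * (norm x)\<^sup>2 \<le> Re (cinner (?A x) x)"
      by (simp add: cinner_adjoint_left[OF G] cinner_self)
  qed
  let ?S = "op_sqrt ?A"
  note S = op_sqrt_coercive[OF A1 A2 A3]
  have SS: "?S (?S x) = ?A x" for x
    using S(3) by (metis blinfun_apply_blinfun_compose)
  \<comment> \<open>The inverse of the root S is S A^(- 1). It is a right inverse at once; it is a
    left inverse because S is injective.\<close>
  have invS: "op_invertible ?S"
    unfolding op_invertible_def
  proof (intro exI conjI; rule blinfun_eqI)
    fix x
    show "(?S o\<^sub>L (?S o\<^sub>L op_inverse ?A)) x = id_blinfun x"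
      using op_inverse(1)[OF inv, of x] by (simp add: SS)
    have inj: "y = z" if "?S y = ?S z" for y z
      by (metis SS op_inverse(2)[OF inv] that)
    have "?S (?S (op_inverse ?A (?S x))) = ?S x"
      unfolding SS by (rule op_inverse(1)[OF inv])
    then have "?S (op_inverse ?A (?S x)) = x" by (rule inj)
    then show "((?S o\<^sub>L op_inverse ?A) o\<^sub>L ?S) x = id_blinfun x" by simp
  qed
  show "clinear (blinfun_apply h)"
    unfolding h_def by (intro clinear_op_inverse invS S)
  show "op_invertible h" unfolding h_def by (intro op_invertible_inverse invS)
  have Sh: "?S (h x) = x" for x unfolding h_def by (rule op_inverse(1)[OF invS])
  show herm: "hermitian h"
    unfolding hermitian_def by (metis S(2) Sh hermitian_def)
  have "cinner (G (h x)) (G (h y)) = cinner (h x) (?S (?S (h y)))"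
    unfolding SS by (simp add: cinner_adjoint[OF G])
  also have "\<dots> = cinner (?S (h x)) (?S (h y))"
    using S(2) by (metis hermitian_def)
  finally show "cinner (G (h x)) (G (h y)) = cinner x y" by (simp add: Sh)
qed

section \<open>Symmetric operators and their models\<close>

lemma closed_subspace_orth_orth:
  fixes S :: "'a::{complex_inner,complete_space} set"
  assumes "closed S" and S: "complex_vector.subspace S"
    and x: "\<And>y. y \<in> orth_compl S \<Longrightarrow> cinner x y = 0"
  shows "x \<in> S"
proof -
  have "subspace S"
    using S by (auto simp: subspace_def complex_vector.subspace_def scaleR_scaleC)
  then obtain s where s: "s \<in> S" "\<forall>y\<in>S. inner (x - s) y = 0"
    using closed_subspace_projection assms(1) by metis
  \<comment> \<open>\<open>S\<close> is closed under multiplication by \<i>, so real orthogonality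
    applied to y and to \<i> y gives complex orthogonality.\<close>
  have "cinner (x - s) y = 0" if "y \<in> S" for y
    using s(2) that S
    by (simp add: complex_eq_iff Im_cinner inner_eq_Re_cinner[symmetric] complex_vector.subspace_scale)
  then have orth: "cinner y (x - s) = 0" if "y \<in> S" for y
    using that by (metis cinner_commute complex_cnj_zero)
  then have "cinner x (x - s) = 0"
    by (intro x) (simp add: orth_compl_def)
  then have "cinner (x - s) (x - s) = 0"
    using orth[OF s(1)] by (simp add: cinner.diff_left)
  then show ?thesis using s(1) by (simp add: cinner_self)
qed

text \<open>The number \<open>cinner (T x) x\<close> is real, so the imaginary part of
  \<open>cinner (T x - w *\<^sub>C x) x\<close> comes from \<open>w\<close> alone.\<close>

lemma symmetric_shift_lower_bound:
  assumes "symmetric_operator D T" "x \<in> D"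
  shows "\<bar>Im w\<bar> * norm x \<le> norm (T x - w *\<^sub>C x)"
proof (cases "x = 0")
  case False
  have "Im (cinner (T x) x) = 0"
    using assms cinner_commute[of "T x" x] by (simp add: symmetric_operator_def complex_eq_iff)
  then have "Im (cinner (T x - w *\<^sub>C x) x) = - Im w * (norm x)\<^sup>2"
    by (simp add: cinner.diff_left cinner_scaleC_left cinner_self)
  moreover have "\<bar>Im (cinner (T x - w *\<^sub>C x) x)\<bar> \<le> norm (T x - w *\<^sub>C x) * norm (\<i> *\<^sub>C x)"
    unfolding Im_cinner by (rule Cauchy_Schwarz_ineq2)
  ultimately have "(\<bar>Im w\<bar> * norm x) * norm x \<le> norm (T x - w *\<^sub>C x) * norm x"
    by (simp add: norm_scaleC abs_mult power2_eq_square mult.assoc)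
  then show ?thesis using False by simp
qed simp

lemma subspace_rng_shift:
  assumes "linear_operator D T"
  shows "complex_vector.subspace (rng_shift D T w)"
proof (rule complex_vector.subspaceI)
  note D = assms[unfolded linear_operator_def]
  have "T 0 = 0"
    using D complex_vector.subspace_0[of D] by (metis add_cancel_right_left)
  then show "0 \<in> rng_shift D T w"
    using D complex_vector.subspace_0[of D] by (auto simp: rng_shift_def image_iff intro!: bexI[of _ 0])
  show "a + b \<in> rng_shift D T w" if ab: "a \<in> rng_shift D T w" "b \<in> rng_shift D T w" for a b
  proof -
    obtain x y where "x \<in> D" "y \<in> D" "a = T x - w *\<^sub>C x" "b = T y - w *\<^sub>C y"
      using ab unfolding rng_shift_def by blast
    then show ?thesis
      using D by (auto simp: rng_shift_def scaleC_add_right complex_vector.subspace_add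
          intro!: image_eqI[of _ _ "x + y"])
  qed
  show "c *\<^sub>C a \<in> rng_shift D T w" if a: "a \<in> rng_shift D T w" for c a
  proof -
    obtain x where "x \<in> D" "a = T x - w *\<^sub>C x"
      using a unfolding rng_shift_def by blast
    then show ?thesis
      using D by (auto simp: rng_shift_def scaleC_diff_right scaleC_scaleC mult.commute
          complex_vector.subspace_scale intro!: image_eqI[of _ _ "c *\<^sub>C x"])
  qed
qed

text \<open>The lower bound makes preimages of a convergent sequence Cauchy; closedness of the graph
  then puts the limit in the range.\<close>

lemma closed_rng_shift:
  fixes D :: "'a::{complex_inner,complete_space} set"
  assumes lin: "linear_operator D T" and "closed_operator D T" and sym: "symmetric_operator D T"
    and w: "Im w \<noteq> 0"
  shows "closed (rng_shift D T w)"
  unfolding closed_sequential_limits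
proof (intro allI impI)
  fix s l assume s: "(\<forall>n. s n \<in> rng_shift D T w) \<and> s \<longlonglongrightarrow> l"
  then have "\<forall>n. \<exists>x\<in>D. s n = T x - w *\<^sub>C x" by (auto simp: rng_shift_def)
  then obtain x where x: "x n \<in> D" "s n = T (x n) - w *\<^sub>C x n" for n by metis
  have bound: "\<bar>Im w\<bar> * norm (x m - x n) \<le> norm (s m - s n)" for m n
  proof -
    have D: "x m - x n \<in> D" "T (x m - x n) = T (x m) - T (x n)"
    proof -
      show D: "x m - x n \<in> D"
        using lin x by (auto simp: linear_operator_def complex_vector.subspace_diff)
      have "T (x m) = T ((x m - x n) + x n)" by simp
      also have "\<dots> = T (x m - x n) + T (x n)"
        using lin D x(1) unfolding linear_operator_def by blast
      finally show "T (x m - x n) = T (x m) - T (x n)" by simp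
    qed
    show ?thesis
      using symmetric_shift_lower_bound[OF sym D(1), of w]
      by (simp add: D(2) x(2) scaleC_diff_right algebra_simps)
  qed
  have "Cauchy x"
  proof (rule metric_CauchyI)
    fix e :: real assume "e > 0"
    then have "\<bar>Im w\<bar> * e > 0" using w by simp
    moreover have "Cauchy s" using s LIMSEQ_imp_Cauchy by blast
    ultimately obtain M where M: "\<forall>m\<ge>M. \<forall>n\<ge>M. dist (s m) (s n) < \<bar>Im w\<bar> * e"
      by (meson metric_CauchyD)
    have "dist (x m) (x n) < e" if "m \<ge> M" "n \<ge> M" for m n
    proof -
      have "\<bar>Im w\<bar> * norm (x m - x n) < \<bar>Im w\<bar> * e"
        using bound[of m n] M that by (auto simp: dist_norm intro: le_less_trans)
      then show ?thesis using w by (simp add: dist_norm)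
    qed
    then show "\<exists>M. \<forall>m\<ge>M. \<forall>n\<ge>M. dist (x m) (x n) < e" by blast
  qed
  then obtain y where y: "x \<longlonglongrightarrow> y"
    using Cauchy_convergent convergent_def by blast
  have "(\<lambda>n. s n + w *\<^sub>C x n) \<longlonglongrightarrow> l + w *\<^sub>C y"
    using s y by (intro tendsto_add bounded_linear.tendsto[OF bounded_linear_scaleC]) auto
  then have "(\<lambda>n. T (x n)) \<longlonglongrightarrow> l + w *\<^sub>C y" by (simp add: x(2))
  then have lim: "(\<lambda>n. (x n, T (x n))) \<longlonglongrightarrow> (y, l + w *\<^sub>C y)" by (rule tendsto_Pair[OF y])
  have "(x n, T (x n)) \<in> (\<lambda>x. (x, T x)) ` D" for n
    by (rule image_eqI[of _ _ "x n"]) (simp_all add: x(1))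
  moreover have "closed ((\<lambda>x. (x, T x)) ` D)"
    using \<open>closed_operator D T\<close> by (simp only: closed_operator_def)
  ultimately have "(y, l + w *\<^sub>C y) \<in> (\<lambda>x. (x, T x)) ` D"
    by (intro closed_sequentially[OF _ _ lim])
  then have "y \<in> D" and Ty: "T y = l + w *\<^sub>C y" by auto
  moreover have "l = T y - w *\<^sub>C y" unfolding Ty by simp
  ultimately show "l \<in> rng_shift D T w"
    unfolding rng_shift_def by (intro image_eqI[of _ _ y])
qed

text \<open>
  A dense subset of \<open>\<complex> - \<real>\<close> that avoids \<open>\<plusminus> \<i>\<close> and contains no pair of conjugate points: the
  kernel of a model is determined by its characteristic function only off such pairs.
\<close>

definition unpaired :: "complex set" where
  "unpaired = {z. (Im z > 0 \<and> Im z \<notin> \<rat>) \<or> (Im z < 0 \<and> Im z \<in> \<rat> \<and> Im z \<noteq> - 1)}"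

lemma unpaired_nonreal: "z \<in> unpaired \<Longrightarrow> Im z \<noteq> 0"
  by (auto simp: unpaired_def)

lemma unpaired_neq_ii: "z \<in> unpaired \<Longrightarrow> z \<noteq> \<i>" "z \<in> unpaired \<Longrightarrow> z \<noteq> - \<i>"
  by (auto simp: unpaired_def)

lemma unpaired_neq_cnj: "z \<in> unpaired \<Longrightarrow> w \<in> unpaired \<Longrightarrow> w \<noteq> cnj z"
  by (auto simp: unpaired_def)

text \<open>Density on vertical lines: irrational heights are used in the upper half plane, rational
  ones in the lower.\<close>

lemma continuous_zero_unpaired:
  fixes f :: "complex \<Rightarrow> complex"
  assumes f: "continuous_on {z. Im z \<noteq> 0} f" and zero: "\<And>z. z \<in> unpaired \<Longrightarrow> f z = 0"
    and w: "Im w \<noteq> 0"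
  shows "f w = 0"
proof (rule ccontr)
  assume "f w \<noteq> 0"
  have op: "open {z :: complex. Im z \<noteq> 0}"
    by (intro open_Collect_neq continuous_intros)
  then have "open ({z. Im z \<noteq> 0} \<inter> f -` (- {0}))"
    using f by (intro continuous_open_preimage) auto
  moreover have "w \<in> {z. Im z \<noteq> 0} \<inter> f -` (- {0})" using \<open>f w \<noteq> 0\<close> w by simp
  ultimately obtain e where "e > 0" "ball w e \<subseteq> {z. Im z \<noteq> 0} \<inter> f -` (- {0})"
    by (rule openE)
  then have e: "e > 0" "ball w e \<subseteq> f -` (- {0})" by auto
  have "\<exists>y. \<bar>y - Im w\<bar> < e \<and> Complex (Re w) y \<in> unpaired"
  proof (cases "Im w > 0")
    case True
    have "uncountable {Im w<..<Im w + e}" using e by (simp add: uncountable_open_interval)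
    then have "\<not> {Im w<..<Im w + e} \<subseteq> \<rat>" using countable_rat countable_subset by blast
    then obtain y where "y \<in> {Im w<..<Im w + e}" "y \<notin> \<rat>" by blast
    then show ?thesis using True by (intro exI[of _ y]) (auto simp: unpaired_def)
  next
    case False
    \<comment> \<open>The cap keeps \<open>y\<close> below 0, and below - 1 if \<open>Im w\<close>
      is; in the other case \<open>y > Im w\<close> already excludes \<open>y = - 1\<close>.\<close>
    define b where "b = min (Im w + e) (if Im w < - 1 then - 1 else 0)"
    have "Im w < b" using False w e by (auto simp: b_def)
    then obtain y where "y \<in> \<rat>" "Im w < y" "y < b"
      using Rats_dense_in_real[OF \<open>Im w < b\<close>] by blast
    then show ?thesis
      by (intro exI[of _ y]) (auto simp: unpaired_def b_def split: if_splits)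
  qed
  then obtain y where y: "\<bar>y - Im w\<bar> < e" "Complex (Re w) y \<in> unpaired" by blast
  have "w - Complex (Re w) y = \<i> * of_real (Im w - y)" by (simp add: complex_eq_iff)
  then have "Complex (Re w) y \<in> ball w e"
    using y(1) by (simp add: dist_norm norm_mult abs_minus_commute del: of_real_diff)
  then show False using e(2) zero[OF y(2)] by auto
qed

section \<open>Recovering the operator from its model\<close>

locale operator_model =
  fixes D :: "'a::{complex_inner,complete_space} set" and T :: "'a \<Rightarrow> 'a"
    and \<Gamma> :: "complex \<Rightarrow> 'k::{complex_inner,banach} \<Rightarrow>\<^sub>L 'a"
  assumes linear: "linear_operator D T" and closed: "closed_operator D T"
    and symmetric: "symmetric_operator D T" and model: "is_model D T \<Gamma>"
begin

lemma clinear_model: "Im w \<noteq> 0 \<Longrightarrow> clinear (blinfun_apply (\<Gamma> w))"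
  using model by (simp add: is_model_def)

lemma kernel_invertible:
  "(Im w > 0 \<and> Im z > 0) \<or> (Im w < 0 \<and> Im z < 0) \<Longrightarrow> op_invertible (model_kernel \<Gamma> w z)"
  using model by (auto simp: is_model_def model_kernel_def)

lemma range_model: "Im w \<noteq> 0 \<Longrightarrow> range (blinfun_apply (\<Gamma> w)) = orth_compl (rng_shift D T w)"
  using model by (auto simp: is_model_def bij_betw_def)

lemma shift_orth_model: "Im w \<noteq> 0 \<Longrightarrow> x \<in> D \<Longrightarrow> cinner (T x - w *\<^sub>C x) (\<Gamma> w k) = 0"
  using range_model[of w] rangeI[of "blinfun_apply (\<Gamma> w)" k]
  by (auto simp: orth_compl_def rng_shift_def)

lemma cinner_T_model: "Im w \<noteq> 0 \<Longrightarrow> x \<in> D \<Longrightarrow> cinner (T x) (\<Gamma> w k) = w * cinner x (\<Gamma> w k)"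
  using shift_orth_model[of w x k] by (simp add: cinner.diff_left cinner_scaleC_left)

text \<open>The range of T - w is a closed subspace, hence equal to its double orthogonal
  complement, and its complement is the range of \<open>\<Gamma> w\<close>.\<close>

lemma in_rng_shift:
  assumes w: "Im w \<noteq> 0" and x: "\<And>k. cinner x (\<Gamma> w k) = 0"
  obtains y where "y \<in> D" "x = T y - w *\<^sub>C y"
proof -
  have "x \<in> rng_shift D T w"
  proof (rule closed_subspace_orth_orth)
    show "closed (rng_shift D T w)" by (rule closed_rng_shift[OF linear closed symmetric w])
    show "complex_vector.subspace (rng_shift D T w)" by (rule subspace_rng_shift[OF linear])
    show "cinner x y = 0" if "y \<in> orth_compl (rng_shift D T w)" for y
      using that x unfolding range_model[OF w, symmetric] by auto
  qed
  then show ?thesis using that by (auto simp: rng_shift_def)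
qed

text \<open>Co-analyticity makes \<open>\<lambda>z. \<Gamma> (cnj z)\<close> differentiable;
  composing with conjugation once more gives continuity of \<open>\<Gamma>\<close> itself.\<close>

lemma continuous_model: "continuous_on {z. Im z \<noteq> 0} (\<lambda>z. \<Gamma> z k)"
proof -
  have img: "cnj ` {z. Im z \<noteq> 0} = {z. Im z \<noteq> 0}"
    by (auto simp: image_iff intro!: exI[of _ "cnj _"])
  have "continuous_on (cnj ` {z. Im z \<noteq> 0}) (\<lambda>z. \<Gamma> (cnj z))"
    using model unfolding is_model_def op_coanalytic_on_def op_holomorphic_on_def
      continuous_on_eq_continuous_within
    by (blast intro: has_derivative_continuous)
  then have "continuous_on {z. Im z \<noteq> 0} (\<lambda>z. \<Gamma> (cnj (cnj z)))"
    by (rule continuous_on_compose2[where g = "\<lambda>z. \<Gamma> (cnj z)"]) (auto intro: continuous_intros)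
  then show ?thesis by (intro continuous_intros) simp
qed

lemma model_orth_extend:
  assumes "\<And>z k. z \<in> unpaired \<Longrightarrow> cinner (y - z *\<^sub>C x) (\<Gamma> z k) = 0" and w: "Im w \<noteq> 0"
  shows "cinner (y - w *\<^sub>C x) (\<Gamma> w k) = 0"
proof -
  have eq: "cinner (y - z *\<^sub>C x) (\<Gamma> z k) = cinner y (\<Gamma> z k) - z * cinner x (\<Gamma> z k)" for z
    by (simp add: cinner.diff_left cinner_scaleC_left)
  have "continuous_on {z. Im z \<noteq> 0} (\<lambda>z. cinner (y - z *\<^sub>C x) (\<Gamma> z k))"
    unfolding eq by (intro continuous_intros cinner.continuous_on continuous_model)
  then show ?thesis using assms by (rule continuous_zero_unpaired)
qed

text \<open>Orthogonality on \<open>unpaired\<close> extends by continuity to all nonreal points,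
  where the ranges of \<open>\<Gamma>\<close> span a dense subspace.\<close>

lemma model_total:
  assumes "\<And>z k. z \<in> unpaired \<Longrightarrow> cinner x (\<Gamma> z k) = 0"
  shows "x = 0"
proof -
  let ?S = "{y. cinner x y = 0}"
  have zero: "cinner x (\<Gamma> w k) = 0" if "Im w \<noteq> 0" for w k
    using model_orth_extend[of x 0 w k] assms that by simp
  have "complex_vector.span (\<Union>w\<in>{w. Im w \<noteq> 0}. range (blinfun_apply (\<Gamma> w))) \<subseteq> ?S"
    by (rule complex_vector.span_minimal)
      (auto simp: zero complex_vector.subspace_def cinner_add_right cinner_scaleC_right
        cinner.zero_right)
  moreover have "closed ?S"
    by (intro closed_Collect_eq cinner.continuous_on continuous_intros)
  ultimately have "closed_span (\<Union>w\<in>{w. Im w \<noteq> 0}. range (blinfun_apply (\<Gamma> w))) \<subseteq> ?S"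
    unfolding closed_span_def by (rule closure_minimal)
  then have "cinner x x = 0" using model unfolding is_model_def by blast
  then show ?thesis by (simp add: cinner_self)
qed

text \<open>In the transform \<open>z \<mapsto> \<Gamma> z* x\<close> the operator \<open>T\<close> is multiplication by \<open>z\<close> on its maximal domain.\<close>

lemma graph_iff:
  "x \<in> D \<and> T x = y \<longleftrightarrow> (\<forall>z\<in>unpaired. \<forall>k. cinner (y - z *\<^sub>C x) (\<Gamma> z k) = 0)"
proof
  show "\<forall>z\<in>unpaired. \<forall>k. cinner (y - z *\<^sub>C x) (\<Gamma> z k) = 0" if "x \<in> D \<and> T x = y"
    using that shift_orth_model unpaired_nonreal by auto
next
  assume asm: "\<forall>z\<in>unpaired. \<forall>k. cinner (y - z *\<^sub>C x) (\<Gamma> z k) = 0"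
  have "cinner (y - \<i> *\<^sub>C x) (\<Gamma> \<i> k) = 0" for k
    by (rule model_orth_extend) (use asm in simp_all)
  then obtain u where u: "u \<in> D" "y - \<i> *\<^sub>C x = T u - \<i> *\<^sub>C u"
    using in_rng_shift[of \<i> "y - \<i> *\<^sub>C x"] by auto
  \<comment> \<open>Pairing y - \<i> x = T u - \<i> u with \<open>\<Gamma> z k\<close> gives the
    factor z - \<i> times the pairing of x - u, and z is different from \<i> on
    \<open>unpaired\<close>.\<close>
  have "x - u = 0"
  proof (rule model_total)
    fix z k assume z: "z \<in> unpaired"
    then have "cinner (T u) (\<Gamma> z k) = z * cinner u (\<Gamma> z k)"
      by (intro cinner_T_model unpaired_nonreal u)
    moreover have "cinner y (\<Gamma> z k) = z * cinner x (\<Gamma> z k)"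
      using asm z by (simp add: cinner.diff_left cinner_scaleC_left)
    moreover have "cinner (y - \<i> *\<^sub>C x) (\<Gamma> z k) = cinner (T u - \<i> *\<^sub>C u) (\<Gamma> z k)"
      by (simp only: u(2))
    ultimately have "z * cinner x (\<Gamma> z k) - \<i> * cinner x (\<Gamma> z k)
        = z * cinner u (\<Gamma> z k) - \<i> * cinner u (\<Gamma> z k)"
      by (simp only: cinner.diff_left cinner_scaleC_left)
    then have "(z - \<i>) * cinner (x - u) (\<Gamma> z k) = 0"
      by (simp add: cinner.diff_left left_diff_distrib right_diff_distrib)
    then show "cinner (x - u) (\<Gamma> z k) = 0" using unpaired_neq_ii[OF z] by simp
  qed
  then show "x \<in> D \<and> T x = y" using u by simp
qed

section \<open>The kernel in isometric coordinates of the deficiency spaces\<close>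

definition inv_sqrt :: "complex \<Rightarrow> 'k \<Rightarrow>\<^sub>L 'k" where
  "inv_sqrt w = op_inverse (op_sqrt (model_kernel \<Gamma> w w))"

text \<open>A common form of \<Phi> and \<Psi>, which are the cases \<open>w = \<i>\<close> and
  \<open>w = - \<i>\<close>.\<close>

definition \<Theta> :: "complex \<Rightarrow> complex \<Rightarrow> 'k \<Rightarrow>\<^sub>L 'k" where
  "\<Theta> w z = model_kernel \<Gamma> w z o\<^sub>L inv_sqrt w"

text \<open>The adjoint of \<open>\<Theta> w z\<close>. Its values are the coordinates of the
  projection of \<open>\<Gamma> z k\<close> onto the range of \<open>\<Gamma> w\<close>.\<close>

definition \<theta> :: "complex \<Rightarrow> complex \<Rightarrow> 'k \<Rightarrow> 'k" where
  "\<theta> w z k = inv_sqrt w (model_kernel \<Gamma> z w k)"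

lemma model_Phi_eq: "model_Phi \<Gamma> z = \<Theta> \<i> z" and model_Psi_eq: "model_Psi \<Gamma> z = \<Theta> (- \<i>) z"
  by (simp_all add: model_Phi_def model_Psi_def \<Theta>_def inv_sqrt_def)

lemma
  assumes "Im w \<noteq> 0"
  shows clinear_inv_sqrt: "clinear (blinfun_apply (inv_sqrt w))"
    and hermitian_inv_sqrt: "cinner (inv_sqrt w x) y = cinner x (inv_sqrt w y)"
    and invertible_inv_sqrt: "op_invertible (inv_sqrt w)"
    and cinner_model_inv_sqrt: "cinner (\<Gamma> w (inv_sqrt w x)) (\<Gamma> w (inv_sqrt w y)) = cinner x y"
proof -
  have "Im w > 0 \<or> Im w < 0" using assms by linarith
  then have "op_invertible (op_adjoint (\<Gamma> w) o\<^sub>L \<Gamma> w)"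
    using kernel_invertible[of w w] unfolding model_kernel_def by blast
  note wh = whitening[OF clinear_model[OF assms] this, folded model_kernel_def, folded inv_sqrt_def]
  show "clinear (blinfun_apply (inv_sqrt w))" "cinner (inv_sqrt w x) y = cinner x (inv_sqrt w y)" "op_invertible (inv_sqrt w)"
    "cinner (\<Gamma> w (inv_sqrt w x)) (\<Gamma> w (inv_sqrt w y)) = cinner x y"
    using wh unfolding hermitian_def by blast+
qed

lemma \<Theta>_apply: "\<Theta> w z x = op_adjoint (\<Gamma> z) (\<Gamma> w (inv_sqrt w x))"
  by (simp add: \<Theta>_def model_kernel_def)

lemma \<theta>_apply: "\<theta> w z x = inv_sqrt w (op_adjoint (\<Gamma> w) (\<Gamma> z x))"
  by (simp add: \<theta>_def model_kernel_def)

lemma cinner_\<Theta>: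
  assumes "Im w \<noteq> 0" "Im z \<noteq> 0"
  shows "cinner (\<Theta> w z x) k = cinner x (\<theta> w z k)"
  by (simp add: \<Theta>_apply \<theta>_apply assms cinner_adjoint_left clinear_model cinner_adjoint hermitian_inv_sqrt)

lemma
  assumes "(Im w > 0 \<and> Im z > 0) \<or> (Im w < 0 \<and> Im z < 0)"
  shows invertible_\<Theta>: "op_invertible (\<Theta> w z)" and bij_\<theta>: "bij (\<theta> w z)"
proof -
  show "op_invertible (\<Theta> w z)"
    unfolding \<Theta>_def using assms
    by (intro op_invertible_compose kernel_invertible invertible_inv_sqrt) auto
  have "bij (blinfun_apply (inv_sqrt w o\<^sub>L model_kernel \<Gamma> z w))"
    using assms by (intro op_invertible_bij op_invertible_compose kernel_invertible invertible_inv_sqrt) auto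
  moreover have "\<theta> w z = blinfun_apply (inv_sqrt w o\<^sub>L model_kernel \<Gamma> z w)"
    by (rule ext) (simp add: \<theta>_def)
  ultimately show "bij (\<theta> w z)" by simp
qed

text \<open>
  \<open>proj w\<close> is the orthogonal projection onto the range of \<open>\<Gamma> w\<close>, since \<open>\<Gamma> w \<circ> inv_sqrt w\<close> is isometric.
\<close>

definition proj :: "complex \<Rightarrow> 'a \<Rightarrow> 'a" where
  "proj w x = \<Gamma> w (inv_sqrt w (inv_sqrt w (op_adjoint (\<Gamma> w) x)))"

lemma proj_orth:
  assumes w: "Im w \<noteq> 0"
  shows "cinner (x - proj w x) (\<Gamma> w k) = 0"
proof -
  obtain m where m: "k = inv_sqrt w m" using op_inverse(1)[OF invertible_inv_sqrt[OF w]] by metis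
  have "cinner (proj w x) (\<Gamma> w k) = cinner (inv_sqrt w (op_adjoint (\<Gamma> w) x)) m"
    unfolding proj_def m by (rule cinner_model_inv_sqrt[OF w])
  also have "\<dots> = cinner x (\<Gamma> w k)"
    by (simp add: m hermitian_inv_sqrt[OF w] cinner_adjoint_left[OF clinear_model[OF w]])
  finally show ?thesis by (simp add: cinner.diff_left)
qed

lemma cinner_proj_model:
  assumes "Im w \<noteq> 0" "Im z \<noteq> 0" "Im u \<noteq> 0"
  shows "cinner (proj w (\<Gamma> z k)) (\<Gamma> u l) = cinner (\<theta> w z k) (\<theta> w u l)"
  by (simp add: proj_def \<theta>_apply cinner_adjoint clinear_model assms hermitian_inv_sqrt)

lemma proj_exists:
  assumes "Im w \<noteq> 0"
  obtains y where "y \<in> D" "x - proj w x = T y - w *\<^sub>C y"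
  using in_rng_shift[OF assms proj_orth[OF assms]] by blast

lemma cinner_proj:
  assumes "Im w \<noteq> 0" "u \<in> D"
  shows "cinner (x - proj w x) (T u - w *\<^sub>C u) = cinner x (T u - w *\<^sub>C u)"
proof -
  have "cinner (proj w x) (T u - w *\<^sub>C u) = cnj (cinner (T u - w *\<^sub>C u) (proj w x))"
    by (rule cinner_commute)
  also have "\<dots> = 0" unfolding proj_def by (simp add: shift_orth_model[OF assms])
  finally show ?thesis by (simp add: cinner.diff_left)
qed

text \<open>
  With \<open>e - proj \<i> e = (T - \<i>) x\<close>, the Cayley transform \<open>(T - \<i>) x \<mapsto> (T + \<i>) x\<close> being isometric
  forces \<open>(T + \<i>) x\<close> to be a multiple of \<open>e - proj (- \<i>) e\<close>.
\<close>

lemma kernel_identity: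
  assumes z: "Im z \<noteq> 0" and w: "Im w \<noteq> 0"
  shows "(cnj z - \<i>) * (w + \<i>) * (cinner (\<Gamma> z k) (\<Gamma> w l) - cinner (\<theta> \<i> z k) (\<theta> \<i> w l)) =
    (cnj z + \<i>) * (w - \<i>) * (cinner (\<Gamma> z k) (\<Gamma> w l) - cinner (\<theta> (- \<i>) z k) (\<theta> (- \<i>) w l))"
proof -
  define e f where "e = \<Gamma> z k" and "f = \<Gamma> w l"
  obtain x where x: "x \<in> D" "e - proj \<i> e = T x - \<i> *\<^sub>C x"
    using proj_exists[of \<i> e] by auto
  obtain y where y: "y \<in> D" "e - proj (- \<i>) e = T y - (- \<i>) *\<^sub>C y"
    using proj_exists[of "- \<i>" e] by auto
  have T: "cinner e (T u) = cnj z * cinner e u" if "u \<in> D" for u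
    unfolding e_def using cinner_T_model[OF z that, of k] cinner_commute complex_cnj_mult by metis
  have sym: "cinner (T u) v = cinner u (T v)" if "u \<in> D" "v \<in> D" for u v
    using symmetric that by (simp add: symmetric_operator_def)
  \<comment> \<open>Symmetry of \<open>T\<close> lets both shifts change sign together, the
    projection onto the deficiency space drops out, and \<open>e\<close> acts as an eigenvector of
    the adjoint for \<open>cnj z\<close>.\<close>
  have ex: "cinner (T x + \<i> *\<^sub>C x) (T u + \<i> *\<^sub>C u) = (cnj z + \<i>) * cinner e u" if u: "u \<in> D" for u
  proof -
    have "cinner (T x + \<i> *\<^sub>C x) (T u + \<i> *\<^sub>C u) = cinner (T x - \<i> *\<^sub>C x) (T u - \<i> *\<^sub>C u)"
      using sym[OF x(1) u]
      by (simp add: cinner.diff_left cinner.diff_right cinner.add_left cinner.add_right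
          cinner_scaleC_left cinner_scaleC_right algebra_simps)
    also have "\<dots> = cinner e (T u - \<i> *\<^sub>C u)" unfolding x(2)[symmetric] by (intro cinner_proj u) simp
    finally show ?thesis by (simp add: T[OF u] cinner.diff_right cinner_scaleC_right algebra_simps)
  qed
  have ey: "cinner (T y + \<i> *\<^sub>C y) (T u + \<i> *\<^sub>C u) = (cnj z - \<i>) * cinner e u" if u: "u \<in> D" for u
  proof -
    have "cinner (T y - (- \<i>) *\<^sub>C y) (T u - (- \<i>) *\<^sub>C u) = cinner e (T u - (- \<i>) *\<^sub>C u)"
      unfolding y(2)[symmetric] by (intro cinner_proj u) simp
    then show ?thesis by (simp add: T[OF u] cinner.add_right cinner_scaleC_right algebra_simps)
  qed
  \<comment> \<open>\<open>d\<close> lies in the range of T + \<i> and turns out to be orthogonal to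
    that range, so it vanishes.\<close>
  define d where "d = (cnj z - \<i>) *\<^sub>C (T x + \<i> *\<^sub>C x) - (cnj z + \<i>) *\<^sub>C (T y + \<i> *\<^sub>C y)"
  have d0: "cinner d (T u + \<i> *\<^sub>C u) = 0" if "u \<in> D" for u
    by (simp add: d_def cinner.diff_left cinner_scaleC_left ex[OF that] ey[OF that])
  have "cinner d d = cinner d ((cnj z - \<i>) *\<^sub>C (T x + \<i> *\<^sub>C x)) - cinner d ((cnj z + \<i>) *\<^sub>C (T y + \<i> *\<^sub>C y))"
    by (subst (2) d_def) (rule cinner.diff_right)
  also have "\<dots> = 0" by (simp add: cinner_scaleC_right d0 x y)
  finally have "d = 0" by (simp add: cinner_self)
  then have "cinner ((cnj z - \<i>) *\<^sub>C (T x + \<i> *\<^sub>C x)) f = cinner ((cnj z + \<i>) *\<^sub>C (T y + \<i> *\<^sub>C y)) f"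
    by (simp add: d_def)
  \<comment> \<open>Against \<open>f\<close> both shifts of \<open>T\<close> act on \<open>x\<close>
    as scalars, so multiplying by w - \<i> replaces (T + \<i>) x by (T - \<i>) x.\<close>
  moreover have "cinner (T x + \<i> *\<^sub>C x) f = (w + \<i>) * cinner x f"
    "cinner (T x - \<i> *\<^sub>C x) f = (w - \<i>) * cinner x f"
    unfolding f_def
    by (simp_all add: cinner.add_left cinner.diff_left cinner_scaleC_left cinner_T_model[OF w x(1)]
        algebra_simps)
  ultimately have "(cnj z - \<i>) * (w + \<i>) * cinner (e - proj \<i> e) f
      = (cnj z + \<i>) * (w - \<i>) * cinner (e - proj (- \<i>) e) f"
    unfolding x(2) y(2) by (simp add: cinner_scaleC_left mult_ac)
  then show ?thesis
    by (simp add: e_def f_def cinner.diff_left cinner_proj_model z w)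
qed

text \<open>The kernel identity solved for the kernel; the factor on the left vanishes exactly for
  \<open>w = cnj z\<close>.\<close>

lemma cinner_model_eq:
  assumes z: "Im z \<noteq> 0" and w: "Im w \<noteq> 0"
  shows "2 * \<i> * (cnj z - w) * cinner (\<Gamma> z k) (\<Gamma> w l) =
    (cnj z - \<i>) * (w + \<i>) * cinner (\<theta> \<i> z k) (\<theta> \<i> w l) -
    (cnj z + \<i>) * (w - \<i>) * cinner (\<theta> (- \<i>) z k) (\<theta> (- \<i>) w l)"
proof -
  have "2 * \<i> * (cnj z - w) = (cnj z - \<i>) * (w + \<i>) - (cnj z + \<i>) * (w - \<i>)"
    by (simp add: algebra_simps)
  moreover have expand: "(a - b) * g = a * p - b * q" if "a * (g - p) = b * (g - q)"
    for a b g p q :: complex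
    using that by (simp add: algebra_simps)
  ultimately show ?thesis
    by (simp only: expand[OF kernel_identity[OF assms]])
qed

text \<open>At a conjugate pair both coefficients of the kernel identity equal (z - \<i>) (z +
  \<i>), which is nonzero here, so the kernel term cancels.\<close>

lemma conjugate_identity:
  assumes z: "Im z \<noteq> 0" "z \<noteq> \<i>" "z \<noteq> - \<i>"
  shows "cinner (\<theta> \<i> (cnj z) k) (\<theta> \<i> z l) = cinner (\<theta> (- \<i>) (cnj z) k) (\<theta> (- \<i>) z l)"
proof -
  have "z - \<i> \<noteq> 0" "z + \<i> \<noteq> 0" using z by (auto simp: eq_neg_iff_add_eq_0)
  then show ?thesis
    using kernel_identity[of "cnj z" z k l] z(1) by (simp add: mult.commute)
qed

end

section \<open>Unitary operators\<close>

lemma norm_eq_if_cinner_eq: "cinner x x = cinner y y \<Longrightarrow> norm x = norm y"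
  by (simp add: cinner_self of_real_eq_iff[symmetric] del: of_real_power)

lemma unitary_cinner: "unitary U \<Longrightarrow> cinner (U x) (U y) = cinner x y"
  and unitary_surj: "unitary U \<Longrightarrow> surj U"
  and unitary_clinear: "unitary U \<Longrightarrow> clinear U"
  by (simp_all add: unitary_def)

lemma unitary_norm: "unitary U \<Longrightarrow> norm (U x) = norm x"
  by (rule norm_eq_if_cinner_eq) (rule unitary_cinner)

lemma unitary_inj: "unitary U \<Longrightarrow> inj U"
proof (rule injI)
  fix x y assume U: "unitary U" "U x = U y"
  then have "norm (x - y) = norm (U x - U y)"
    using unitary_norm[OF U(1), of "x - y"] by (simp add: clinear_diff[OF unitary_clinear[OF U(1)]])
  then show "x = y" using U(2) by simp
qed

lemma unitary_bij: "unitary U \<Longrightarrow> bij U"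
  by (simp add: bij_def unitary_inj unitary_surj)

lemma unitary_bounded_linear: "unitary U \<Longrightarrow> bounded_linear U"
  by (rule bounded_linear_intro[where K = 1])
    (simp_all add: unitary_norm unitary_clinear clinear_add clinear_scaleC scaleR_scaleC)

lemma unitary_inv:
  assumes U: "unitary U"
  shows "unitary (inv U)"
proof -
  have UI: "U (inv U x) = x" for x by (rule surj_f_inv_f[OF unitary_surj[OF U]])
  have IU: "inv U (U x) = x" for x by (rule inv_f_f[OF unitary_inj[OF U]])
  show ?thesis
    unfolding unitary_def
  proof (intro conjI allI)
    show "clinear (inv U)"
    proof (rule clinearI)
      show "inv U (x + y) = inv U x + inv U y" for x y
        using IU[of "inv U x + inv U y"] by (simp add: clinear_add[OF unitary_clinear[OF U]] UI)
      show "inv U (c *\<^sub>C x) = c *\<^sub>C inv U x" for c x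
        using IU[of "c *\<^sub>C inv U x"] by (simp add: clinear_scaleC[OF unitary_clinear[OF U]] UI)
    qed
    show "surj (inv U)" using bij_imp_bij_inv[OF unitary_bij[OF U]] by (rule bij_is_surj)
    show "cinner (inv U x) (inv U y) = cinner x y" for x y
      using unitary_cinner[OF U, of "inv U x" "inv U y"] by (simp add: UI)
  qed
qed

text \<open>
  This relation is closed and linear. For families with equal Gram matrices it contains all pairs
  \<open>(e i, f i)\<close>, so it is isometric, and it is the graph of the unitary that maps \<open>e i\<close> to \<open>f i\<close>.
\<close>

definition gram_related :: "('i \<Rightarrow> 'a::complex_inner) \<Rightarrow> ('i \<Rightarrow> 'b::complex_inner) \<Rightarrow> 'i set \<Rightarrow> 'a \<Rightarrow> 'b \<Rightarrow> bool" where
  "gram_related e f I x y \<longleftrightarrow>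
    (\<forall>x' y'. (\<forall>i\<in>I. cinner x' (e i) = cinner y' (f i)) \<longrightarrow> cinner x x' = cinner y y')"

text \<open>Symmetry in the two families lets surjectivity of the unitary follow from the existence
  statement with the roles exchanged.\<close>

lemma gram_related_swap: "gram_related f e I y x = gram_related e f I x y"
  unfolding gram_related_def by (subst all_comm) (simp add: eq_commute)

lemma gram_related_add:
  "gram_related e f I x y \<Longrightarrow> gram_related e f I x' y' \<Longrightarrow> gram_related e f I (x + x') (y + y')"
  unfolding gram_related_def cinner_add_left
  by (intro allI impI arg_cong2[where f = "(+)"]) blast+

lemma gram_related_scaleC:
  "gram_related e f I x y \<Longrightarrow> gram_related e f I (c *\<^sub>C x) (c *\<^sub>C y)"
  by (simp add: gram_related_def cinner_scaleC_left)

lemma gram_related_diff: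
  "gram_related e f I x y \<Longrightarrow> gram_related e f I x' y' \<Longrightarrow> gram_related e f I (x - x') (y - y')"
  unfolding gram_related_def cinner.diff_left
  by (intro allI impI arg_cong2[where f = "(-)"]) blast+

context
  fixes e :: "'i \<Rightarrow> 'a::{complex_inner,complete_space}"
    and f :: "'i \<Rightarrow> 'b::{complex_inner,complete_space}" and I :: "'i set"
  assumes gram: "\<forall>i\<in>I. \<forall>j\<in>I. cinner (e i) (e j) = cinner (f i) (f j)"
begin

lemma gram_related_member: "i \<in> I \<Longrightarrow> gram_related e f I (e i) (f i)"
  unfolding gram_related_def by (metis cinner_commute)

text \<open>By equality of the Gram matrices a related pair is itself an admissible test pair in the
  definition.\<close>

lemma gram_related_cinner:
  assumes "gram_related e f I x y" "gram_related e f I x' y'"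
  shows "cinner x x' = cinner y y'"
proof -
  have "cinner x' (e i) = cinner y' (f i)" if "i \<in> I" for i
    using assms(2) gram that unfolding gram_related_def by blast
  then show ?thesis using assms(1) unfolding gram_related_def by blast
qed

lemma gram_related_norm: "gram_related e f I x y \<Longrightarrow> norm x = norm y"
proof -
  assume "gram_related e f I x y"
  then have "cinner x x = cinner y y" by (intro gram_related_cinner)
  then show ?thesis
    by (simp only: cinner_self of_real_eq_iff) simp
qed

text \<open>The domain of the relation is a closed complex subspace containing every
  \<open>e i\<close>, so totality leaves only zero in its orthogonal complement.\<close>

lemma gram_related_total:
  assumes total: "\<And>x. (\<And>i. i \<in> I \<Longrightarrow> cinner x (e i) = 0) \<Longrightarrow> x = 0"
  shows "\<exists>y. gram_related e f I x y"
proof -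
  let ?S = "{x. \<exists>y. gram_related e f I x y}"
  have "x \<in> ?S"
  proof (rule closed_subspace_orth_orth)
    show "complex_vector.subspace ?S"
      unfolding complex_vector.subspace_def
    proof (intro conjI ballI allI)
      have "gram_related e f I 0 0" by (simp add: gram_related_def cinner.zero_left)
      then show "0 \<in> ?S" by blast
    qed (use gram_related_add gram_related_scaleC in blast)+
    show "closed ?S"
      unfolding closed_sequential_limits
    proof (intro allI impI)
      fix s l assume s: "(\<forall>n. s n \<in> ?S) \<and> s \<longlonglongrightarrow> l"
      then have "\<forall>n. \<exists>y. gram_related e f I (s n) y" by blast
      then obtain t where t: "gram_related e f I (s n) (t n)" for n by metis
      \<comment> \<open>Partners of a convergent sequence have the same mutual distances, so they
        converge as well.\<close>
      have "dist (s m) (s n) = dist (t m) (t n)" for m n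
        unfolding dist_norm by (intro gram_related_norm gram_related_diff t)
      moreover have "Cauchy s" using s LIMSEQ_imp_Cauchy by blast
      ultimately have "Cauchy t" by (simp add: Cauchy_def)
      then obtain k where k: "t \<longlonglongrightarrow> k" using Cauchy_convergent convergent_def by blast
      have "gram_related e f I l k"
        unfolding gram_related_def
      proof (intro allI impI)
        fix x' y' assume "\<forall>i\<in>I. cinner x' (e i) = cinner y' (f i)"
        then have "cinner (s n) x' = cinner (t n) y'" for n
          using t unfolding gram_related_def by blast
        moreover have "(\<lambda>n. cinner (s n) x') \<longlonglongrightarrow> cinner l x'"
          using s by (intro cinner.tendsto tendsto_const) auto
        moreover have "(\<lambda>n. cinner (t n) y') \<longlonglongrightarrow> cinner k y'"
          by (intro cinner.tendsto tendsto_const k)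
        ultimately show "cinner l x' = cinner k y'" by (simp add: LIMSEQ_unique)
      qed
      then show "l \<in> ?S" by blast
    qed
    fix y assume y: "y \<in> orth_compl ?S"
    have "y = 0"
    proof (rule total)
      fix i assume "i \<in> I"
      then have "e i \<in> ?S" using gram_related_member by blast
      then have "cinner (e i) y = 0" using y by (simp only: orth_compl_def mem_Collect_eq)
      then show "cinner y (e i) = 0" by (metis cinner_commute complex_cnj_zero)
    qed
    then show "cinner x y = 0" by (simp add: cinner.zero_right)
  qed
  then show ?thesis by simp
qed

end

lemma unitary_of_equal_gram:
  fixes e :: "'i \<Rightarrow> 'a::{complex_inner,complete_space}"
    and f :: "'i \<Rightarrow> 'b::{complex_inner,complete_space}"
  assumes gram: "\<And>i j. i \<in> I \<Longrightarrow> j \<in> I \<Longrightarrow> cinner (e i) (e j) = cinner (f i) (f j)"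
    and total_e: "\<And>x. (\<And>i. i \<in> I \<Longrightarrow> cinner x (e i) = 0) \<Longrightarrow> x = 0"
    and total_f: "\<And>y. (\<And>i. i \<in> I \<Longrightarrow> cinner y (f i) = 0) \<Longrightarrow> y = 0"
  obtains U where "unitary U" "\<And>i. i \<in> I \<Longrightarrow> U (e i) = f i"
proof -
  let ?R = "gram_related e f I"
  have ef: "\<forall>i\<in>I. \<forall>j\<in>I. cinner (e i) (e j) = cinner (f i) (f j)"
    and fe: "\<forall>i\<in>I. \<forall>j\<in>I. cinner (f i) (f j) = cinner (e i) (e j)"
    using gram by simp_all
  note member = gram_related_member[OF ef]
  note cin = gram_related_cinner[OF ef]
  note nrm = gram_related_norm[OF ef]
  obtain U where U: "?R x (U x)" for x
    using gram_related_total[OF ef total_e] by metis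
  have uniq: "U x = y" if "?R x y" for x y
  proof -
    have "norm (x - x) = norm (U x - y)" by (intro nrm gram_related_diff U that)
    then show ?thesis by simp
  qed
  have "unitary U"
    unfolding unitary_def
  proof (intro conjI allI)
    show "clinear U"
      by (rule clinearI) (auto intro!: uniq gram_related_add gram_related_scaleC U)
    show "surj U"
    proof (rule surjI)
      fix y
      have "\<exists>x. gram_related f e I y x"
        by (rule gram_related_total[OF fe total_f])
      then have "\<exists>x. ?R x y" by (simp only: gram_related_swap[of f e I])
      then show "U (SOME x. ?R x y) = y" by (intro uniq) (rule someI_ex)
    qed
    show "cinner (U x) (U y) = cinner x y" for x y
      by (rule cin[OF U U, symmetric])
  qed
  then show ?thesis by (rule that) (intro uniq member)
qed

section \<open>Models and their characteristic functions\<close>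

locale two_models =
  M1: operator_model D1 T1 \<Gamma>1 + M2: operator_model D2 T2 \<Gamma>2
  for D1 :: "'a::{complex_inner,complete_space} set" and T1
    and D2 :: "'b::{complex_inner,complete_space} set" and T2
    and \<Gamma>1 :: "complex \<Rightarrow> 'k::{complex_inner,banach} \<Rightarrow>\<^sub>L 'a" and \<Gamma>2 :: "complex \<Rightarrow> 'k \<Rightarrow>\<^sub>L 'b"
begin

lemma model_V_apply:
  "model_V \<Gamma>1 z x = ((z - \<i>) / (z + \<i>)) *\<^sub>C op_inverse (M1.\<Theta> \<i> z) (M1.\<Theta> (- \<i>) z x)"
  "model_V \<Gamma>2 z x = ((z - \<i>) / (z + \<i>)) *\<^sub>C op_inverse (M2.\<Theta> \<i> z) (M2.\<Theta> (- \<i>) z x)"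
  by (simp_all add: model_V_def scaleC_blinfun.rep_eq M1.model_Phi_eq M1.model_Psi_eq
      M2.model_Phi_eq M2.model_Psi_eq)

section \<open>From a unitary equivalence to the characteristic functions\<close>

lemma model_V_equiv_if_unitarily_equivalent:
  assumes "unitarily_equivalent D1 T1 D2 T2"
  shows "\<exists>R Q :: 'k \<Rightarrow>\<^sub>L 'k. unitary (blinfun_apply R) \<and> unitary (blinfun_apply Q) \<and>
      (\<forall>z. Im z > 0 \<longrightarrow> model_V \<Gamma>1 z = R o\<^sub>L model_V \<Gamma>2 z o\<^sub>L Q)"
proof -
  obtain U where U: "unitary U" "U ` D1 = D2" "\<And>x. x \<in> D1 \<Longrightarrow> U (T1 x) = T2 (U x)"
    using assms by (auto simp: unitarily_equivalent_def)
  have shift: "T2 (U x) - w *\<^sub>C U x = U (T1 x - w *\<^sub>C x)" if "x \<in> D1" for x w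
    using that by (simp add: U(3)[symmetric] clinear_diff clinear_scaleC unitary_clinear[OF U(1)])
  have orth: "v \<in> orth_compl (rng_shift D1 T1 w) \<longleftrightarrow> U v \<in> orth_compl (rng_shift D2 T2 w)" for v w
    unfolding orth_compl_def rng_shift_def U(2)[symmetric]
    by (simp add: shift unitary_cinner[OF U(1)])
  have to2: "\<exists>m. \<Gamma>2 w m = U (\<Gamma>1 w k)" if w: "Im w \<noteq> 0" for w k
    using orth[of "\<Gamma>1 w k" w] unfolding M1.range_model[OF w, symmetric] M2.range_model[OF w, symmetric]
    by (metis rangeE rangeI)
  have to1: "\<exists>k. U (\<Gamma>1 w k) = \<Gamma>2 w m" if w: "Im w \<noteq> 0" for w m
  proof -
    obtain v where v: "U v = \<Gamma>2 w m" using unitary_surj[OF U(1)] by (metis surjD)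
    then show ?thesis
      using orth[of v w] unfolding M1.range_model[OF w, symmetric] M2.range_model[OF w, symmetric]
      by (metis rangeE rangeI)
  qed
  have "\<exists>m. \<Gamma>2 w (M2.inv_sqrt w m) = U (\<Gamma>1 w (M1.inv_sqrt w k))" if w: "Im w \<noteq> 0" for w k
    using to2[OF w] op_inverse(1)[OF M2.invertible_inv_sqrt[OF w]] by metis
  \<comment> \<open>\<open>q w\<close> is the matrix of \<open>U\<close> between the deficiency
    spaces at \<open>w\<close>, in their isometric coordinates.\<close>
  then obtain q where q: "\<Gamma>2 w (M2.inv_sqrt w (q w k)) = U (\<Gamma>1 w (M1.inv_sqrt w k))" if "Im w \<noteq> 0" for w k
    by metis
  have qc: "cinner (q w x) (q w y) = cinner x y" if w: "Im w \<noteq> 0" for w x y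
    using M2.cinner_model_inv_sqrt[OF w, of "q w x" "q w y"]
    by (simp add: q w unitary_cinner[OF U(1)] M1.cinner_model_inv_sqrt)
  have inj2: "x = y" if "Im w \<noteq> 0" "\<Gamma>2 w (M2.inv_sqrt w x) = \<Gamma>2 w (M2.inv_sqrt w y)" for w x y
    using that M2.cinner_model_inv_sqrt by (metis cinner_eqI)
  have q_unitary: "unitary (q w)" if w: "Im w \<noteq> 0" for w
    unfolding unitary_def
  proof (intro conjI allI)
    note lin = clinear_add[OF unitary_clinear[OF U(1)]] clinear_scaleC[OF unitary_clinear[OF U(1)]]
      clinear_scaleC[OF M1.clinear_model[OF w]] clinear_scaleC[OF M1.clinear_inv_sqrt[OF w]]
      clinear_scaleC[OF M2.clinear_model[OF w]] clinear_scaleC[OF M2.clinear_inv_sqrt[OF w]]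
    show "clinear (q w)"
      by (rule clinearI; rule inj2[OF w]) (simp_all add: q w lin blinfun.add_right)
    show "surj (q w)"
    proof (rule surjI)
      fix m
      have "\<exists>k. q w k = m"
        using to1[OF w, of "M2.inv_sqrt w m"] q[OF w] inj2[OF w] op_inverse(1)[OF M1.invertible_inv_sqrt[OF w]]
        by metis
      then show "q w (SOME k. q w k = m) = m" by (rule someI_ex)
    qed
    show "cinner (q w x) (q w y) = cinner x y" for x y by (rule qc[OF w])
  qed
  \<comment> \<open>\<open>A z\<close> expresses \<open>U\<close> between the deficiency spaces at
    \<open>z\<close> in the given coordinates \<open>\<Gamma>1 z\<close> and
    \<open>\<Gamma>2 z\<close>.\<close>
  obtain A where A: "\<Gamma>2 z (A z k) = U (\<Gamma>1 z k)" if "Im z \<noteq> 0" for z k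
    using to2 by metis
  have \<theta>A: "M2.\<theta> w z (A z k) = q w (M1.\<theta> w z k)" if w: "Im w \<noteq> 0" and z: "Im z \<noteq> 0" for w z k
  proof (rule cinner_eqI_left)
    fix m
    obtain l where l: "m = q w l" using unitary_surj[OF q_unitary[OF w]] by (metis surjD)
    have "cinner (M2.\<theta> w z (A z k)) m = cinner (U (\<Gamma>1 z k)) (\<Gamma>2 w (M2.inv_sqrt w m))"
      by (simp add: M2.\<theta>_apply M2.hermitian_inv_sqrt[OF w] cinner_adjoint_left M2.clinear_model w A z)
    also have "\<dots> = cinner (\<Gamma>1 z k) (\<Gamma>1 w (M1.inv_sqrt w l))"
      by (simp add: l q w unitary_cinner[OF U(1)])
    also have "\<dots> = cinner (M1.\<theta> w z k) l"
      by (simp add: M1.\<theta>_apply M1.hermitian_inv_sqrt[OF w] cinner_adjoint_left M1.clinear_model w)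
    finally show "cinner (M2.\<theta> w z (A z k)) m = cinner (q w (M1.\<theta> w z k)) m"
      by (simp add: l qc[OF w])
  qed
  have \<Theta>A: "cinner (M1.\<Theta> w z x) k = cinner (M2.\<Theta> w z (q w x)) (A z k)"
    if "Im w \<noteq> 0" "Im z \<noteq> 0" for w z x k
    using that by (simp add: M1.cinner_\<Theta> M2.cinner_\<Theta> \<theta>A qc)
  have qi: "unitary (q \<i>)" "unitary (q (- \<i>))" by (simp_all add: q_unitary)
  \<comment> \<open>Formally \<Theta>1(w, z) is the adjoint of A(z) times \<Theta>2(w, z) q(w). In
    \<Phi>^(- 1) \<Psi> the outer factor cancels, leaving the inverse of q(\<i>) on the left and q(-
    \<i>) on the right.\<close>
  define R Q where "R = Blinfun (inv (q \<i>))" and "Q = Blinfun (q (- \<i>))"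
  have R: "blinfun_apply R = inv (q \<i>)" and Q: "blinfun_apply Q = q (- \<i>)"
    unfolding R_def Q_def by (intro bounded_linear_Blinfun_apply unitary_bounded_linear unitary_inv qi)+
  have "model_V \<Gamma>1 z x = (R o\<^sub>L model_V \<Gamma>2 z o\<^sub>L Q) x" if z: "Im z > 0" for z x
  proof -
    define y where "y = op_inverse (M2.\<Theta> \<i> z) (M2.\<Theta> (- \<i>) z (Q x))"
    have y: "M2.\<Theta> \<i> z y = M2.\<Theta> (- \<i>) z (Q x)"
      unfolding y_def by (rule op_inverse(1)[OF M2.invertible_\<Theta>]) (use z in simp)
    have qR: "q \<i> (R y) = y"
      unfolding R by (rule surj_f_inv_f[OF unitary_surj[OF qi(1)]])
    have "M1.\<Theta> \<i> z (R y) = M1.\<Theta> (- \<i>) z x"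
      by (rule cinner_eqI_left) (use z in \<open>simp add: \<Theta>A qR y Q\<close>)
    then have "op_inverse (M1.\<Theta> \<i> z) (M1.\<Theta> (- \<i>) z x) = R y"
      using op_inverse(2)[OF M1.invertible_\<Theta>, of \<i> z "R y"] z by simp
    then show ?thesis
      using clinear_scaleC[OF unitary_clinear[OF unitary_inv[OF qi(1)]]]
      by (simp add: model_V_apply y_def[symmetric] R)
  qed
  then show ?thesis
    using qi R Q unitary_inv by (intro exI[of _ R] exI[of _ Q]) (auto intro: blinfun_eqI)
qed

section \<open>From the characteristic functions to a unitary equivalence\<close>

context
  fixes R Q :: "'k \<Rightarrow>\<^sub>L 'k"
  assumes R: "unitary (blinfun_apply R)" and Q: "unitary (blinfun_apply Q)"
    and V: "\<And>z. Im z > 0 \<Longrightarrow> model_V \<Gamma>1 z = R o\<^sub>L model_V \<Gamma>2 z o\<^sub>L Q"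
begin

text \<open>The relation between the characteristic functions with the inverses of \<Phi> cleared;
  the scalar factor can be cancelled because \<open>z \<noteq> \<i>\<close>.\<close>

lemma \<Theta>_eq_if_model_V_eq:
  assumes z: "Im z > 0" "z \<noteq> \<i>" and y: "M2.\<Theta> \<i> z y = M2.\<Theta> (- \<i>) z (Q x)"
  shows "M1.\<Theta> \<i> z (R y) = M1.\<Theta> (- \<i>) z x"
proof -
  define b where "b = (z - \<i>) / (z + \<i>)"
  have "z + \<i> \<noteq> 0" using z by (auto simp: complex_eq_iff)
  then have b: "b \<noteq> 0" using z by (simp add: b_def)
  have inv: "op_invertible (M1.\<Theta> \<i> z)" "op_invertible (M2.\<Theta> \<i> z)"
    using z by (simp_all add: M1.invertible_\<Theta> M2.invertible_\<Theta>)
  have "b *\<^sub>C op_inverse (M1.\<Theta> \<i> z) (M1.\<Theta> (- \<i>) z x) = model_V \<Gamma>1 z x"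
    by (simp add: model_V_apply b_def)
  also have "\<dots> = R (b *\<^sub>C op_inverse (M2.\<Theta> \<i> z) (M2.\<Theta> (- \<i>) z (Q x)))"
    by (simp add: V[OF z(1)] model_V_apply b_def)
  also have "\<dots> = b *\<^sub>C R y"
    by (simp add: y[symmetric] op_inverse(2)[OF inv(2)] clinear_scaleC[OF unitary_clinear[OF R]])
  finally have "op_inverse (M1.\<Theta> \<i> z) (M1.\<Theta> (- \<i>) z x) = R y"
    using b complex_vector.scale_left_imp_eq by blast
  then show ?thesis using op_inverse(1)[OF inv(1)] by metis
qed

text \<open>In the upper half plane \<open>\<theta> \<i> z\<close> is bijective for both models, so
  the first equation defines \<open>C\<close>; the second is the adjoint form of the relation
  between the characteristic functions.\<close>

lemma intertwiner_upper:
  assumes z: "Im z > 0" "z \<noteq> \<i>"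
  obtains C where "bij C" "\<And>k. M1.\<theta> \<i> z k = R (M2.\<theta> \<i> z (C k))"
    "\<And>k. M2.\<theta> (- \<i>) z (C k) = Q (M1.\<theta> (- \<i>) z k)"
proof -
  have bij: "bij (M1.\<theta> \<i> z)" "bij (M2.\<theta> \<i> z)" using z by (simp_all add: M1.bij_\<theta> M2.bij_\<theta>)
  define C where "C = inv (M2.\<theta> \<i> z) \<circ> (inv (blinfun_apply R) \<circ> M1.\<theta> \<i> z)"
  have C: "M1.\<theta> \<i> z k = R (M2.\<theta> \<i> z (C k))" for k
    by (simp add: C_def surj_f_inv_f bij_is_surj bij unitary_surj[OF R])
  have "M2.\<theta> (- \<i>) z (C k) = Q (M1.\<theta> (- \<i>) z k)" for k
  proof (rule cinner_eqI)
    fix v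
    obtain x where x: "v = Q x" using unitary_surj[OF Q] by (metis surjD)
    \<comment> \<open>Chosen to move the pairing from the base point - \<i> to \<i>, where
      \<open>C\<close> is known.\<close>
    define y where "y = op_inverse (M2.\<Theta> \<i> z) (M2.\<Theta> (- \<i>) z (Q x))"
    have y: "M2.\<Theta> \<i> z y = M2.\<Theta> (- \<i>) z (Q x)"
      unfolding y_def by (rule op_inverse(1)[OF M2.invertible_\<Theta>]) (use z in simp)
    have "cinner v (M2.\<theta> (- \<i>) z (C k)) = cinner (M2.\<Theta> \<i> z y) (C k)"
      using z by (simp add: x y M2.cinner_\<Theta>)
    also have "\<dots> = cinner y (M2.\<theta> \<i> z (C k))"
      using z by (simp add: M2.cinner_\<Theta>)
    also have "\<dots> = cinner (R y) (M1.\<theta> \<i> z k)"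
      by (simp add: C unitary_cinner[OF R])
    also have "\<dots> = cinner (M1.\<Theta> (- \<i>) z x) k"
      using z by (simp add: M1.cinner_\<Theta>[symmetric] \<Theta>_eq_if_model_V_eq[OF z y])
    also have "\<dots> = cinner v (Q (M1.\<theta> (- \<i>) z k))"
      using z by (simp add: x M1.cinner_\<Theta> unitary_cinner[OF Q])
    finally show "cinner v (M2.\<theta> (- \<i>) z (C k)) = cinner v (Q (M1.\<theta> (- \<i>) z k))" .
  qed
  moreover have "bij C"
    unfolding C_def by (intro bij_comp bij_imp_bij_inv bij unitary_bij R)
  ultimately show ?thesis using that C by blast
qed

text \<open>Here \<open>\<theta> (- \<i>) z\<close> is bijective and the second equation defines
  \<open>C\<close>. The first is tested on the values of \<open>\<theta> \<i> (cnj z)\<close>, which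
  exhaust the space, and passes through the conjugate identity.\<close>

lemma intertwiner_lower:
  assumes z: "Im z < 0" "z \<noteq> - \<i>"
  obtains C where "bij C" "\<And>k. M1.\<theta> \<i> z k = R (M2.\<theta> \<i> z (C k))"
    "\<And>k. M2.\<theta> (- \<i>) z (C k) = Q (M1.\<theta> (- \<i>) z k)"
proof -
  have z': "Im (cnj z) > 0" "cnj z \<noteq> \<i>" "Im z \<noteq> 0" "z \<noteq> \<i>"
    using z by (auto simp: complex_eq_iff)
  obtain B where B: "\<And>k. M1.\<theta> \<i> (cnj z) k = R (M2.\<theta> \<i> (cnj z) (B k))"
    "\<And>k. M2.\<theta> (- \<i>) (cnj z) (B k) = Q (M1.\<theta> (- \<i>) (cnj z) k)"
    using intertwiner_upper[OF z'(1,2)] by metis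
  have bij: "bij (M1.\<theta> (- \<i>) z)" "bij (M2.\<theta> (- \<i>) z)" "bij (M1.\<theta> \<i> (cnj z))"
    using z by (simp_all add: M1.bij_\<theta> M2.bij_\<theta>)
  define C where "C = inv (M2.\<theta> (- \<i>) z) \<circ> (blinfun_apply Q \<circ> M1.\<theta> (- \<i>) z)"
  have C: "M2.\<theta> (- \<i>) z (C k) = Q (M1.\<theta> (- \<i>) z k)" for k
    by (simp add: C_def surj_f_inv_f bij_is_surj bij)
  have "M1.\<theta> \<i> z l = R (M2.\<theta> \<i> z (C l))" for l
  proof (rule cinner_eqI)
    fix v
    obtain k where k: "v = M1.\<theta> \<i> (cnj z) k" using bij_is_surj[OF bij(3)] by (metis surjD)
    have "cinner v (M1.\<theta> \<i> z l) = cinner (M1.\<theta> (- \<i>) (cnj z) k) (M1.\<theta> (- \<i>) z l)"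
      unfolding k by (rule M1.conjugate_identity[OF z'(3,4) z(2)])
    also have "\<dots> = cinner (M2.\<theta> (- \<i>) (cnj z) (B k)) (M2.\<theta> (- \<i>) z (C l))"
      by (simp add: B(2) C unitary_cinner[OF Q])
    also have "\<dots> = cinner (M2.\<theta> \<i> (cnj z) (B k)) (M2.\<theta> \<i> z (C l))"
      by (rule M2.conjugate_identity[OF z'(3,4) z(2), symmetric])
    also have "\<dots> = cinner v (R (M2.\<theta> \<i> z (C l)))"
      by (simp add: k B(1) unitary_cinner[OF R])
    finally show "cinner v (M1.\<theta> \<i> z l) = cinner v (R (M2.\<theta> \<i> z (C l)))" .
  qed
  moreover have "bij C"
    unfolding C_def by (intro bij_comp bij_imp_bij_inv bij unitary_bij Q)
  ultimately show ?thesis using that C by blast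
qed

lemma unitarily_equivalent_if_model_V_eq: "unitarily_equivalent D1 T1 D2 T2"
proof -
  have "\<exists>C. bij C \<and> (\<forall>k. M1.\<theta> \<i> z k = R (M2.\<theta> \<i> z (C k))) \<and>
      (\<forall>k. M2.\<theta> (- \<i>) z (C k) = Q (M1.\<theta> (- \<i>) z k))" if "z \<in> unpaired" for z
    using unpaired_nonreal[OF that] unpaired_neq_ii[OF that] intertwiner_upper intertwiner_lower
    by (cases "Im z > 0") (metis linorder_cases)+
  then obtain C where bij_C: "\<And>z. z \<in> unpaired \<Longrightarrow> bij (C z)"
    and C1: "\<And>z k. z \<in> unpaired \<Longrightarrow> M1.\<theta> \<i> z k = R (M2.\<theta> \<i> z (C z k))"
    and C2: "\<And>z k. z \<in> unpaired \<Longrightarrow> M2.\<theta> (- \<i>) z (C z k) = Q (M1.\<theta> (- \<i>) z k)"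
    by metis
  \<comment> \<open>Indices run over points of \<open>unpaired\<close>, where no conjugate pair
    occurs and the kernel is determined by the two coordinate maps.\<close>
  let ?e = "\<lambda>(z, k). \<Gamma>1 z k" and ?f = "\<lambda>(z, k). \<Gamma>2 z (C z k)"
  let ?I = "unpaired \<times> (UNIV :: 'k set)"
  have surj_C: "\<exists>m. k = C z m" if "z \<in> unpaired" for z k
    using bij_is_surj[OF bij_C[OF that]] by (metis surjD)
  have gram: "cinner (\<Gamma>1 z k) (\<Gamma>1 w l) = cinner (\<Gamma>2 z (C z k)) (\<Gamma>2 w (C w l))"
    if z: "z \<in> unpaired" and w: "w \<in> unpaired" for z w k l
  proof -
    have "cinner (M1.\<theta> \<i> z k) (M1.\<theta> \<i> w l) = cinner (M2.\<theta> \<i> z (C z k)) (M2.\<theta> \<i> w (C w l))"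
      "cinner (M1.\<theta> (- \<i>) z k) (M1.\<theta> (- \<i>) w l)
        = cinner (M2.\<theta> (- \<i>) z (C z k)) (M2.\<theta> (- \<i>) w (C w l))"
      by (simp_all add: C1 C2 z w unitary_cinner[OF R] unitary_cinner[OF Q])
    then have "2 * \<i> * (cnj z - w) * cinner (\<Gamma>1 z k) (\<Gamma>1 w l)
        = 2 * \<i> * (cnj z - w) * cinner (\<Gamma>2 z (C z k)) (\<Gamma>2 w (C w l))"
      unfolding M1.cinner_model_eq[OF unpaired_nonreal[OF z] unpaired_nonreal[OF w]]
        M2.cinner_model_eq[OF unpaired_nonreal[OF z] unpaired_nonreal[OF w]]
      by simp
    then show ?thesis using unpaired_neq_cnj[OF z w] by auto
  qed
  obtain U where U: "unitary U" "\<And>i. i \<in> ?I \<Longrightarrow> U (?e i) = ?f i"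
  proof (rule unitary_of_equal_gram[of ?I ?e ?f])
    show "cinner (?e i) (?e j) = cinner (?f i) (?f j)" if "i \<in> ?I" "j \<in> ?I" for i j
      using that gram by (cases i; cases j) simp
    show "x = 0" if x: "\<And>i. i \<in> ?I \<Longrightarrow> cinner x (?e i) = 0" for x
      by (rule M1.model_total) (use x in fastforce)
    show "y = 0" if y: "\<And>i. i \<in> ?I \<Longrightarrow> cinner y (?f i) = 0" for y
    proof (rule M2.model_total)
      fix z k assume z: "z \<in> unpaired"
      obtain m where "k = C z m" using surj_C[OF z] by blast
      then show "cinner y (\<Gamma>2 z k) = 0" using y[of "(z, m)"] z by simp
    qed
  qed (rule that)
  have Ue: "U (\<Gamma>1 z k) = \<Gamma>2 z (C z k)" if "z \<in> unpaired" for z k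
    using U(2)[of "(z, k)"] that by simp
  \<comment> \<open>Both graphs are described by orthogonality to the model vectors, which
    \<open>U\<close> transports; surjectivity of each \<open>C z\<close> ensures that all vectors of
    the second model are tested.\<close>
  have graph: "x \<in> D1 \<and> T1 x = y \<longleftrightarrow> U x \<in> D2 \<and> T2 (U x) = U y" for x y
  proof -
    have eq: "cinner (y - z *\<^sub>C x) (\<Gamma>1 z k) = cinner (U y - z *\<^sub>C U x) (\<Gamma>2 z (C z k))"
      if "z \<in> unpaired" for z k
      using unitary_cinner[OF U(1), of "y - z *\<^sub>C x" "\<Gamma>1 z k"]
      by (simp add: Ue[OF that] clinear_diff clinear_scaleC unitary_clinear[OF U(1)])
    show ?thesis
      unfolding M1.graph_iff M2.graph_iff using eq surj_C by metis
  qed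
  have "U ` D1 = D2"
  proof (intro equalityI subsetI)
    show "y \<in> D2" if "y \<in> U ` D1" for y using that graph by auto
    fix y assume y: "y \<in> D2"
    obtain x v where "y = U x" "T2 y = U v" using unitary_surj[OF U(1)] by (metis surjD)
    then show "y \<in> U ` D1" using graph[of x v] y by simp
  qed
  moreover have "U (T1 x) = T2 (U x)" if "x \<in> D1" for x
    using graph[of x "T1 x"] that by simp
  ultimately show ?thesis using U(1) unfolding unitarily_equivalent_def by blast
qed

end

end

theorem corollary4p2:
  fixes n :: enat
    and D1 :: "'a::separable_hilbert_space set" and T1 :: "'a \<Rightarrow> 'a"
    and D2 :: "'b::separable_hilbert_space set" and T2 :: "'b \<Rightarrow> 'b"
    and \<Gamma>1 :: "complex \<Rightarrow> 'k::separable_hilbert_space \<Rightarrow>\<^sub>L 'a"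
    and \<Gamma>2 :: "complex \<Rightarrow> 'k \<Rightarrow>\<^sub>L 'b"
  assumes "S_class n D1 T1" and "S_class n D2 T2"
    and "has_hilbert_dim (UNIV :: 'k set) n"
    and "is_model D1 T1 \<Gamma>1" and "is_model D2 T2 \<Gamma>2"
  shows "unitarily_equivalent D1 T1 D2 T2 \<longleftrightarrow>
    (\<exists>R Q :: 'k \<Rightarrow>\<^sub>L 'k. unitary (blinfun_apply R) \<and> unitary (blinfun_apply Q) \<and>
      (\<forall>z. Im z > 0 \<longrightarrow> model_V \<Gamma>1 z = R o\<^sub>L model_V \<Gamma>2 z o\<^sub>L Q))"
proof -
  interpret two_models D1 T1 D2 T2 \<Gamma>1 \<Gamma>2
    using assms by unfold_locales (simp_all add: S_class_def)
  show ?thesis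
    using model_V_equiv_if_unitarily_equivalent unitarily_equivalent_if_model_V_eq by blast
qed

end
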